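(* Let $r\ge2$ and $d=2r$, let $\mathbb{T}_d$ be the Cayley graph of the free group $\mathbf{F}_r$ of rank $r$ with respect to some basis, and let $\mathcal{P}_r\subseteq\mathbf{F}_r=V(\mathbb{T}_d)$ be the subset of primitive words. Then $$\beta(\mathcal{P}_r)=\begin{cases}2\sqrt{3} & \text{if } r=2,\\ 2r-3+\frac{2r-1}{2r-3} & \text{if } r\ge3.\end{cases}$$
   Context: An element of $\mathbf{F}_r$ is primitive if it belongs to some free basis of $\mathbf{F}_r$. The Cayley graph of $\mathbf{F}_r$ with respect to a basis is the $d$-regular tree with $d=2r$; its root $o$ is the identity element. For $S\subseteq V(\mathbb{T}_d)$, $b_t(S)$ is the number of arbitrary (not necessarily non-backtracking) walks of length $t$ in $\mathbb{T}_d$ that begin at $o$ and end in $S$, and $\beta(S)=\limsup_{t\to\infty}b_t(S)^{1/t}$. *)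

theory Defs
  imports
    "HOL-Algebra.Generated_Groups"
    "HOL-Library.Extended_Real"
    "HOL-Library.Liminf_Limsup"
    "Graph_Theory.Vertex_Walk"
begin

text \<open>
  The letter \<open>(x, True)\<close> stands for the generator \<open>x\<close> and \<open>(x, False)\<close> for its formal inverse.
  Signs are kept separate from group elements, so that \<open>x\<close> and its formal inverse stay distinct
  letters in every group.
\<close>

definition letter_val :: "('a, 'b) monoid_scheme \<Rightarrow> 'a \<times> bool \<Rightarrow> 'a" where
  "letter_val G l = (if snd l then fst l else inv\<^bsub>G\<^esub> (fst l))"

definition word_val :: "('a, 'b) monoid_scheme \<Rightarrow> ('a \<times> bool) list \<Rightarrow> 'a" where
  "word_val G w = foldr (\<lambda>l g. letter_val G l \<otimes>\<^bsub>G\<^esub> g) w \<one>\<^bsub>G\<^esub>"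

definition reduced :: "('a \<times> bool) list \<Rightarrow> bool" where
  "reduced w \<longleftrightarrow> successively (\<lambda>l m. \<not> (fst l = fst m \<and> snd l \<noteq> snd m)) w"

definition free_basis :: "('a, 'b) monoid_scheme \<Rightarrow> 'a set \<Rightarrow> bool" where
  "free_basis G X \<longleftrightarrow>
     X \<subseteq> carrier G \<and> generate G X = carrier G \<and>
     (\<forall>w. reduced w \<and> fst ` set w \<subseteq> X \<and> w \<noteq> [] \<longrightarrow> word_val G w \<noteq> \<one>\<^bsub>G\<^esub>)"

definition primitive_words :: "('a, 'b) monoid_scheme \<Rightarrow> 'a set" where
  "primitive_words G = {g. \<exists>Y. free_basis G Y \<and> g \<in> Y}"

text \<open>
  The undirected Cayley graph is encoded as a symmetric digraph. An arc is the pair of its end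
  vertices, so there are no parallel arcs.
\<close>

definition cayley_graph :: "('a, 'b) monoid_scheme \<Rightarrow> 'a set \<Rightarrow> ('a, 'a \<times> 'a) pre_digraph" where
  "cayley_graph G X =
     \<lparr>verts = carrier G,
      arcs = {(g, g \<otimes>\<^bsub>G\<^esub> s) | g s. g \<in> carrier G \<and> s \<in> X \<union> m_inv G ` X},
      tail = fst, head = snd\<rparr>"

definition walks_to :: "('v, 'e) pre_digraph \<Rightarrow> 'v \<Rightarrow> 'v set \<Rightarrow> nat \<Rightarrow> 'v list set" where
  "walks_to T v S t = {p. vwalk p T \<and> hd p = v \<and> last p \<in> S \<and> vwalk_length p = t}"

definition walk_growth :: "('v, 'e) pre_digraph \<Rightarrow> 'v \<Rightarrow> 'v set \<Rightarrow> ereal" where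
  "walk_growth T v S = limsup (\<lambda>t. ereal (root t (real (card (walks_to T v S t)))))"

end

theory Submission
  imports Defs
begin

text \<open>
  By Whitehead's cut vertex lemma, the Whitehead graph of a cyclically reduced primitive word has a
  vertex \<open>v\<close> and a set \<open>Y\<close> of vertices, not containing \<open>v\<close> and its inverse, that is joined to the
  rest of the graph only through \<open>v\<close>. The lemma is proved with almost invariant sets: if \<open>g\<close>
  belongs to a basis \<open>B\<close> with a further element \<open>h\<close>, then the set of elements whose reduced word
  over \<open>B\<close> begins with \<open>h\<close> is invariant under right multiplication by \<open>g\<close>, and only finitely many
  edges of the Cayley tree join it to its complement. Without a cut vertex every cone of the tree
  would meet one of the two sets in finitely many points only, so one of them would be finite.

  Either the word crosses the cut \<open>Y\<close> a bounded number of times, and the number of such words grows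
  like \<open>(2r - 3) ^ n\<close>; or the Whitehead automorphism of \<open>v\<close> and \<open>Y\<close> shortens it by almost the
  number of crossings. The second kind contributes an arbitrarily small multiple of the
  generating function of all primitive words to itself, so it converges at every
  \<open>\<sigma> < 1 / max (2r - 3) (sqrt (2r - 1))\<close>; the square root comes from conjugation. As the number of
  walks of length \<open>t\<close> to a vertex at distance \<open>n\<close> is at most
  \<open>((2r - 1) \<sigma> + 1 / \<sigma>) ^ t * \<sigma> ^ n\<close>, the upper bound follows. For the lower bound, the words
  \<open>x w\<close>, where \<open>x\<close> is a letter and \<open>w\<close> avoids \<open>x\<close> and its inverse, are primitive, and
  sub-eigenfunctions of the radial adjacency operator bound the number of walks to them.
\<close>


section \<open>Words, reduced words and free bases\<close>

definition linv :: "'a \<times> bool \<Rightarrow> 'a \<times> bool" where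
  "linv l = (fst l, \<not> snd l)"

lemma linv_linv [simp]: "linv (linv l) = l"
  by (simp add: linv_def)

lemma linv_neq [simp]: "linv l \<noteq> l" "l \<noteq> linv l"
  by (auto simp: linv_def prod_eq_iff)

lemma linv_eq_iff [simp]: "linv a = linv b \<longleftrightarrow> a = b"
  by (auto simp: linv_def prod_eq_iff)

lemma fst_linv [simp]: "fst (linv l) = fst l"
  by (simp add: linv_def)

lemma linv_Pair: "linv (x, s) = (x, \<not> s)"
  by (simp add: linv_def)

definition winv :: "('a \<times> bool) list \<Rightarrow> ('a \<times> bool) list" where
  "winv w = rev (map linv w)"

lemma winv_simps [simp]:
  "winv [] = []" "winv (l # w) = winv w @ [linv l]" "winv (u @ v) = winv v @ winv u"
  "length (winv w) = length w" "winv w = [] \<longleftrightarrow> w = []"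
  by (simp_all add: winv_def)

lemma set_winv: "set (winv w) = linv ` set w"
  by (simp add: winv_def)

lemma hd_winv: "w \<noteq> [] \<Longrightarrow> hd (winv w) = linv (last w)"
  by (simp add: winv_def hd_rev last_map)

lemma last_winv: "w \<noteq> [] \<Longrightarrow> last (winv w) = linv (hd w)"
  by (simp add: winv_def last_rev hd_map)

lemma reduced_altdef: "reduced w \<longleftrightarrow> successively (\<lambda>l m. m \<noteq> linv l) w"
  unfolding reduced_def
  by (rule arg_cong2[where f = successively]) (auto simp: fun_eq_iff linv_def prod_eq_iff)

lemma reduced_Nil [simp]: "reduced []" and reduced_single [simp]: "reduced [l]"
  by (simp_all add: reduced_altdef)

lemma reduced_Cons: "reduced (l # w) \<longleftrightarrow> reduced w \<and> (w = [] \<or> hd w \<noteq> linv l)"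
  by (auto simp: reduced_altdef successively_Cons)

lemma reduced_append:
  "reduced (u @ v) \<longleftrightarrow> reduced u \<and> reduced v \<and> (u = [] \<or> v = [] \<or> hd v \<noteq> linv (last u))"
  by (auto simp: reduced_altdef successively_append_iff)

lemma reduced_winv [simp]: "reduced (winv w) \<longleftrightarrow> reduced w"
  unfolding reduced_altdef winv_def successively_rev successively_map
  by (rule arg_cong2[where f = successively]) (auto simp: fun_eq_iff)

section \<open>Free reduction and the evaluation of words\<close>

definition push :: "'a \<times> bool \<Rightarrow> ('a \<times> bool) list \<Rightarrow> ('a \<times> bool) list" where
  "push l w = (if w \<noteq> [] \<and> hd w = linv l then tl w else l # w)"

definition nf :: "('a \<times> bool) list \<Rightarrow> ('a \<times> bool) list" where
  "nf w = foldr push w []"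

lemma nf_simps [simp]: "nf [] = []" "nf (l # w) = push l (nf w)"
  by (simp_all add: nf_def)

lemma reduced_nf: "reduced (nf w)"
  by (induction w) (auto simp: push_def reduced_Cons neq_Nil_conv)

lemma set_push_subset: "set (push l w) \<subseteq> insert l (set w)"
  by (auto simp: push_def dest: list.set_sel(2)[rotated])

lemma set_nf_subset: "set (nf w) \<subseteq> set w"
proof (induction w)
  case (Cons l w)
  then show ?case using set_push_subset[of l "nf w"] by auto
qed simp

lemma length_nf: "length (nf w) \<le> length w"
  by (induction w) (auto simp: push_def)

text \<open>Letters get arbitrary values here, so that the same facts serve \<open>word_val\<close>
  and the homomorphism \<open>ext\<close>, which is given by the images of the letters.\<close>

definition word_prod :: "('a, 'b) monoid_scheme \<Rightarrow> ('l \<Rightarrow> 'a) \<Rightarrow> 'l list \<Rightarrow> 'a" where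
  "word_prod G e w = foldr (\<lambda>l g. e l \<otimes>\<^bsub>G\<^esub> g) w \<one>\<^bsub>G\<^esub>"

lemma word_val_conv_word_prod: "word_val G = word_prod G (letter_val G)"
  by (simp add: fun_eq_iff word_val_def word_prod_def)

context group begin

lemma word_prod_Nil [simp]: "word_prod G e [] = \<one>"
  and word_prod_Cons [simp]: "word_prod G e (l # w) = e l \<otimes> word_prod G e w"
  by (simp_all add: word_prod_def)

lemma word_prod_closed: "(\<And>l. l \<in> set w \<Longrightarrow> e l \<in> carrier G) \<Longrightarrow> word_prod G e w \<in> carrier G"
  by (induction w) auto

lemma word_prod_append:
  assumes "\<And>l. l \<in> set u \<union> set v \<Longrightarrow> e l \<in> carrier G"
  shows "word_prod G e (u @ v) = word_prod G e u \<otimes> word_prod G e v"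
  using assms by (induction u) (auto simp: word_prod_closed m_assoc)

lemma word_prod_nf:
  assumes "\<And>l. l \<in> set w \<Longrightarrow> e l \<in> carrier G" "\<And>l. l \<in> set w \<Longrightarrow> e (linv l) = inv (e l)"
  shows "word_prod G e (nf w) = word_prod G e w"
  using assms
proof (induction w)
  case (Cons l w)
  note sub = set_nf_subset[of w]
  have IH: "word_prod G e (nf w) = word_prod G e w"
    using Cons by auto
  show ?case
  proof (cases "nf w \<noteq> [] \<and> hd (nf w) = linv l")
    case True
    then obtain u where u: "nf w = linv l # u"
      by (cases "nf w") auto
    have c: "e l \<in> carrier G" "word_prod G e u \<in> carrier G"
      using Cons.prems sub u by (auto intro!: word_prod_closed)
    have "word_prod G e w = inv (e l) \<otimes> word_prod G e u"
      using IH u Cons.prems by simp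
    with c u show ?thesis
      by (simp add: push_def m_assoc[symmetric])
  qed (use IH in \<open>auto simp: push_def\<close>)
qed simp

lemma word_prod_winv:
  assumes "\<And>l. l \<in> set w \<Longrightarrow> e l \<in> carrier G" "\<And>l. l \<in> set w \<Longrightarrow> e (linv l) = inv (e l)"
  shows "word_prod G e (winv w) = inv (word_prod G e w)"
  using assms
proof (induction w)
  case (Cons l w)
  have "e m \<in> carrier G" if "m \<in> set (winv w) \<union> set [linv l]" for m
  proof -
    from that have "\<exists>k \<in> set (l # w). m = linv k"
      by (auto simp: set_winv)
    then show ?thesis using Cons.prems by (elim bexE) simp
  qed
  then have "word_prod G e (winv w @ [linv l]) = word_prod G e (winv w) \<otimes> word_prod G e [linv l]"
    by (rule word_prod_append)
  with Cons show ?case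
    by (simp add: inv_mult_group word_prod_closed)
qed simp

end

section \<open>Reduced words as normal forms with respect to a free basis\<close>

locale free_on = group G for G (structure) +
  fixes X
  assumes basis: "free_basis G X"
begin

definition letters :: "('a \<times> bool) set" where
  "letters = X \<times> UNIV"

definition RW :: "('a \<times> bool) list set" where
  "RW = {w. reduced w \<and> set w \<subseteq> letters}"

abbreviation lv :: "'a \<times> bool \<Rightarrow> 'a" where
  "lv \<equiv> letter_val G"

abbreviation wv :: "('a \<times> bool) list \<Rightarrow> 'a" where
  "wv \<equiv> word_val G"

lemma X_subset: "X \<subseteq> carrier G" and generate_X: "generate G X = carrier G"
  using basis by (auto simp: free_basis_def)

lemma linv_letters [simp]: "linv l \<in> letters \<longleftrightarrow> l \<in> letters"
  by (simp add: letters_def mem_Times_iff)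

lemma set_subset_letters_iff: "set w \<subseteq> letters \<longleftrightarrow> fst ` set w \<subseteq> X"
  by (auto simp: letters_def mem_Times_iff)

lemma lv_closed [simp]: "l \<in> letters \<Longrightarrow> lv l \<in> carrier G"
  using X_subset by (auto simp: letters_def letter_val_def)

lemma lv_linv [simp]: "l \<in> letters \<Longrightarrow> lv (linv l) = inv (lv l)"
  using X_subset by (auto simp: letters_def letter_val_def linv_def)

lemma wv_Nil [simp]: "wv [] = \<one>" and wv_Cons: "wv (l # w) = lv l \<otimes> wv w"
  by (simp_all add: word_val_def)

lemma wv_closed [simp]: "set w \<subseteq> letters \<Longrightarrow> wv w \<in> carrier G"
  unfolding word_val_conv_word_prod by (rule word_prod_closed) auto

lemma wv_append: "set u \<subseteq> letters \<Longrightarrow> set v \<subseteq> letters \<Longrightarrow> wv (u @ v) = wv u \<otimes> wv v"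
  unfolding word_val_conv_word_prod by (rule word_prod_append) auto

lemma wv_single [simp]: "l \<in> letters \<Longrightarrow> wv [l] = lv l"
  by (simp add: wv_Cons)

lemma wv_nf [simp]: "set w \<subseteq> letters \<Longrightarrow> wv (nf w) = wv w"
  unfolding word_val_conv_word_prod by (rule word_prod_nf) auto

lemma wv_winv: "set w \<subseteq> letters \<Longrightarrow> wv (winv w) = inv (wv w)"
  unfolding word_val_conv_word_prod by (rule word_prod_winv) auto

lemma set_winv_letters [simp]: "set (winv w) \<subseteq> letters \<longleftrightarrow> set w \<subseteq> letters"
  unfolding set_winv image_subset_iff by auto

lemma nf_in_RW: "set w \<subseteq> letters \<Longrightarrow> nf w \<in> RW"
  using set_nf_subset[of w] by (auto simp: RW_def reduced_nf)

lemma RW_letters: "w \<in> RW \<Longrightarrow> set w \<subseteq> letters" and RW_reduced: "w \<in> RW \<Longrightarrow> reduced w"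
  by (auto simp: RW_def)

lemma Nil_RW [simp]: "[] \<in> RW"
  by (simp add: RW_def)

lemma RW_append_iff:
  "u @ v \<in> RW \<longleftrightarrow> u \<in> RW \<and> v \<in> RW \<and> (u = [] \<or> v = [] \<or> hd v \<noteq> linv (last u))"
  by (auto simp: RW_def reduced_append)

lemma RW_Cons_iff: "l # w \<in> RW \<longleftrightarrow> l \<in> letters \<and> w \<in> RW \<and> (w = [] \<or> hd w \<noteq> linv l)"
  by (auto simp: RW_def reduced_Cons)

lemma winv_RW [simp]: "winv w \<in> RW \<longleftrightarrow> w \<in> RW"
  by (simp add: RW_def)

lemma wv_eq_one: "w \<in> RW \<Longrightarrow> wv w = \<one> \<Longrightarrow> w = []"
  using basis by (auto simp: RW_def free_basis_def set_subset_letters_iff)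

lemma wv_surj:
  assumes "g \<in> carrier G"
  shows "\<exists>w \<in> RW. wv w = g"
proof -
  have "g \<in> generate G X"
    using assms generate_X by simp
  then have "\<exists>w. set w \<subseteq> letters \<and> wv w = g"
  proof induction
    case one
    show ?case by (intro exI[of _ "[]"]) simp
  next
    case (incl h)
    then have "(h, True) \<in> letters" "lv (h, True) = h"
      by (auto simp: letters_def letter_val_def)
    then show ?case by (intro exI[of _ "[(h, True)]"]) simp
  next
    case (inv h)
    then have "(h, False) \<in> letters" "lv (h, False) = inv h"
      by (auto simp: letters_def letter_val_def)
    then show ?case by (intro exI[of _ "[(h, False)]"]) simp
  next
    case (eng h1 h2)
    then obtain u v where "set u \<subseteq> letters" "wv u = h1" "set v \<subseteq> letters" "wv v = h2"
      by auto
    then show ?case by (intro exI[of _ "u @ v"]) (simp add: wv_append)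
  qed
  then obtain w where w: "set w \<subseteq> letters" "wv w = g" by blast
  show ?thesis
    by (rule bexI[of _ "nf w"]) (use w in \<open>auto simp: nf_in_RW\<close>)
qed

text \<open>Equal first letters cancel. If the first letters differ, \<open>winv u @ v\<close> is a
  nonempty reduced word of value \<open>\<one>\<close>, which freeness excludes.\<close>

lemma wv_inj:
  assumes "u \<in> RW" "v \<in> RW" "wv u = wv v"
  shows "u = v"
  using assms
proof (induction u arbitrary: v)
  case Nil
  then show ?case using wv_eq_one[of v] by simp
next
  case (Cons a u)
  show ?case
  proof (cases v)
    case Nil
    then show ?thesis using Cons.prems wv_eq_one[of "a # u"] by simp
  next
    case (Cons b v')
    have au: "a \<in> letters" "u \<in> RW" "a # u \<in> RW" and bv: "b \<in> letters" "v' \<in> RW" "b # v' \<in> RW"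
      using Cons.prems Cons by (auto simp: RW_Cons_iff)
    show ?thesis
    proof (cases "a = b")
      case True
      have "lv a \<otimes> wv u = lv a \<otimes> wv v'"
        using Cons.prems Cons True by (simp add: wv_Cons)
      then have "wv u = wv v'"
        using au bv by (simp add: RW_letters)
      then show ?thesis
        using Cons.IH au bv Cons True by blast
    next
      case False
      have "winv (a # u) @ (b # v') \<in> RW"
        using au bv False unfolding RW_append_iff winv_RW
        by (auto simp: last_winv simp del: winv_simps(2))
      moreover have "wv (winv (a # u) @ (b # v')) = \<one>"
      proof -
        have "wv (winv (a # u) @ (b # v')) = inv (wv (a # u)) \<otimes> wv (b # v')"
          using au(3) bv(3) by (simp only: wv_append wv_winv RW_letters set_winv_letters)
        also have "wv (b # v') = wv (a # u)"
          using Cons Cons.prems by simp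
        finally show ?thesis using au(3) by (simp only: l_inv wv_closed RW_letters)
      qed
      ultimately show ?thesis using wv_eq_one by blast
    qed
  qed
qed

lemma bij_betw_wv: "bij_betw wv RW (carrier G)"
proof (intro bij_betw_imageI inj_onI subset_antisym subsetI)
  fix g assume "g \<in> carrier G"
  then show "g \<in> wv ` RW"
    using wv_surj[of g] by (metis imageI)
qed (use wv_inj RW_letters in auto)

definition rw :: "'a \<Rightarrow> ('a \<times> bool) list" where
  "rw g = inv_into RW wv g"

definition len :: "'a \<Rightarrow> nat" where
  "len g = length (rw g)"

lemma rw_RW [simp]: "g \<in> carrier G \<Longrightarrow> rw g \<in> RW"
  and wv_rw [simp]: "g \<in> carrier G \<Longrightarrow> wv (rw g) = g"
  using bij_betw_wv by (auto simp: rw_def bij_betw_def inv_into_into f_inv_into_f)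

lemma rw_wv [simp]: "w \<in> RW \<Longrightarrow> rw (wv w) = w"
  using bij_betw_wv by (simp add: rw_def bij_betw_def)

lemma rw_wv_nf: "set w \<subseteq> letters \<Longrightarrow> rw (wv w) = nf w"
  using rw_wv[OF nf_in_RW, of w] by simp

lemma rw_letters: "g \<in> carrier G \<Longrightarrow> set (rw g) \<subseteq> letters"
  by (simp add: RW_letters)

lemma rw_eqI: "w \<in> RW \<Longrightarrow> wv w = g \<Longrightarrow> rw g = w"
  by auto

lemma rw_one [simp]: "rw \<one> = []"
  by (rule rw_eqI) auto

lemma rw_lv: "l \<in> letters \<Longrightarrow> rw (lv l) = [l]"
  by (rule rw_eqI) (auto simp: RW_Cons_iff)

lemma lv_inj: "l \<in> letters \<Longrightarrow> m \<in> letters \<Longrightarrow> lv l = lv m \<Longrightarrow> l = m"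
  by (metis rw_lv list.inject)

lemma len_wv_le: "set w \<subseteq> letters \<Longrightarrow> len (wv w) \<le> length w"
  by (simp add: len_def rw_wv_nf length_nf)

lemma len_eq_0_iff: "g \<in> carrier G \<Longrightarrow> len g = 0 \<longleftrightarrow> g = \<one>"
  by (metis len_def length_0_conv rw_one wv_Nil wv_rw)

lemma len_mult_le:
  assumes "g \<in> carrier G" "h \<in> carrier G"
  shows "len (g \<otimes> h) \<le> len g + len h"
proof -
  have "len (wv (rw g @ rw h)) \<le> length (rw g @ rw h)"
    by (rule len_wv_le) (use assms rw_letters in auto)
  then show ?thesis
    using assms by (simp add: wv_append rw_letters) (simp add: len_def)
qed

lemma len_lv [simp]: "l \<in> letters \<Longrightarrow> len (lv l) = 1"
  by (simp add: len_def rw_lv)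

text \<open>One step along an edge of the Cayley tree: back to the parent if \<open>l\<close> undoes
  the last letter, and otherwise on to a child.\<close>

lemma rw_mult_letter:
  assumes "g \<in> carrier G" "l \<in> letters"
  shows "rw (g \<otimes> lv l) =
    (if rw g \<noteq> [] \<and> last (rw g) = linv l then butlast (rw g) else rw g @ [l])"
proof (cases "rw g \<noteq> [] \<and> last (rw g) = linv l")
  case True
  then obtain u where u: "rw g = u @ [linv l]"
    by (metis append_butlast_last_id)
  have uRW: "u \<in> RW"
    using rw_RW[OF assms(1)] u by (simp add: RW_append_iff)
  have "g = wv u \<otimes> inv (lv l)"
    using wv_rw[OF assms(1)] u assms uRW by (simp add: wv_append RW_letters)
  then have "g \<otimes> lv l = wv u"
    using assms uRW by (simp add: m_assoc RW_letters)
  then show ?thesis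
    using u uRW by simp
next
  case False
  have "rw g @ [l] \<in> RW"
    using False assms by (auto simp: RW_append_iff RW_Cons_iff)
  moreover have "wv (rw g @ [l]) = g \<otimes> lv l"
    using assms by (simp add: wv_append rw_letters)
  ultimately have "rw (g \<otimes> lv l) = rw g @ [l]"
    by (rule rw_eqI)
  with False show ?thesis by auto
qed

lemma finite_RW_le:
  assumes "finite X"
  shows "finite {w \<in> RW. length w \<le> n}"
proof (rule finite_subset)
  show "finite {w. set w \<subseteq> letters \<and> length w \<le> n}"
    using assms by (intro finite_lists_length_le) (simp add: letters_def)
qed (use RW_letters in blast)

lemma finite_ball:
  assumes "finite X"
  shows "finite {g \<in> carrier G. len g \<le> n}"
proof (rule finite_subset)
  show "{g \<in> carrier G. len g \<le> n} \<subseteq> wv ` {w \<in> RW. length w \<le> n}"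
  proof
    fix g assume "g \<in> {g \<in> carrier G. len g \<le> n}"
    then show "g \<in> wv ` {w \<in> RW. length w \<le> n}"
      by (intro image_eqI[of _ _ "rw g"]) (auto simp: len_def)
  qed
qed (use finite_RW_le[OF assms] in auto)

text \<open>Universal property of the basis: if \<open>e\<close> maps letters into the group and
  turns \<open>linv\<close> into \<open>inv\<close>, this is the endomorphism with value
  \<open>e l\<close> at \<open>lv l\<close>. Reading off the normal form makes it well
  defined.\<close>

definition ext :: "('a \<times> bool \<Rightarrow> 'a) \<Rightarrow> 'a \<Rightarrow> 'a" where
  "ext e g = word_prod G e (rw g)"

context
  fixes e :: "'a \<times> bool \<Rightarrow> 'a"
  assumes e_closed: "\<And>l. l \<in> letters \<Longrightarrow> e l \<in> carrier G"
    and e_linv: "\<And>l. l \<in> letters \<Longrightarrow> e (linv l) = inv (e l)"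
begin

lemma ext_wv: "set w \<subseteq> letters \<Longrightarrow> ext e (wv w) = word_prod G e w"
  unfolding ext_def rw_wv_nf using e_closed e_linv by (intro word_prod_nf) auto

lemma ext_lv: "l \<in> letters \<Longrightarrow> ext e (lv l) = e l"
  using ext_wv[of "[l]"] e_closed by simp

lemma ext_hom: "ext e \<in> hom G G"
proof (rule homI)
  fix g h assume gh: "g \<in> carrier G" "h \<in> carrier G"
  have "ext e (wv (rw g @ rw h)) = word_prod G e (rw g @ rw h)"
    using gh rw_letters by (intro ext_wv) auto
  also have "\<dots> = ext e g \<otimes> ext e h"
    unfolding ext_def using gh rw_letters e_closed by (intro word_prod_append) blast
  finally show "ext e (g \<otimes> h) = ext e g \<otimes> ext e h"
    using gh by (simp add: wv_append rw_letters)
next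
  show "ext e g \<in> carrier G" if "g \<in> carrier G" for g
    unfolding ext_def using that rw_letters e_closed by (intro word_prod_closed) blast
qed

end

lemma hom_eq_id:
  assumes "\<phi> \<in> hom G G" "\<And>x. x \<in> X \<Longrightarrow> \<phi> x = x" "g \<in> carrier G"
  shows "\<phi> g = g"
proof -
  interpret \<phi>: group_hom G G \<phi>
    using assms(1) by unfold_locales
  have "g \<in> generate G X"
    using assms generate_X by simp
  then show ?thesis
  proof induction
    case (eng h1 h2)
    then show ?case
      using generate_X by simp
  qed (use assms X_subset in auto)
qed

text \<open>An endomorphism that fixes the basis is the identity, so both compositions have to be
  tested on \<open>X\<close> only.\<close>

lemma isoI_inverse:
  assumes "\<phi> \<in> hom G G" "\<psi> \<in> hom G G"
    and "\<And>x. x \<in> X \<Longrightarrow> \<phi> (\<psi> x) = x" "\<And>x. x \<in> X \<Longrightarrow> \<psi> (\<phi> x) = x"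
  shows "\<phi> \<in> iso G G"
proof -
  have "(\<phi> \<circ> \<psi>) g = g" "(\<psi> \<circ> \<phi>) g = g" if "g \<in> carrier G" for g
    using hom_eq_id[OF Group.hom_compose[OF assms(2,1)] _ that]
      hom_eq_id[OF Group.hom_compose[OF assms(1,2)] _ that] assms(3,4) by simp_all
  then have "bij_betw \<phi> (carrier G) (carrier G)"
    using hom_in_carrier[OF assms(1)] hom_in_carrier[OF assms(2)]
    by (intro bij_betw_byWitness[where f' = \<psi>]) auto
  then show ?thesis
    using assms(1) by (simp add: iso_def)
qed

end

text \<open>A word over the image pulls back letter by letter to a word over \<open>Y\<close>, again
  reduced, and \<open>\<phi>\<close> maps the value of the pullback to the value of the word. As
  \<open>\<phi>\<close> is injective, a nontrivial relation would pull back to one over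
  \<open>Y\<close>.\<close>

lemma (in group) free_basis_iso:
  assumes "\<phi> \<in> iso G G" "free_basis G Y"
  shows "free_basis G (\<phi> ` Y)"
  unfolding free_basis_def
proof (intro conjI allI impI)
  interpret Y: free_on G Y
    using assms(2) by unfold_locales
  have hom: "\<phi> \<in> hom G G" and bij: "bij_betw \<phi> (carrier G) (carrier G)"
    using assms(1) by (auto simp: iso_def)
  interpret \<phi>: group_hom G G \<phi>
    using hom by unfold_locales
  show "\<phi> ` Y \<subseteq> carrier G"
    using Y.X_subset by auto
  show "generate G (\<phi> ` Y) = carrier G"
    using \<phi>.generate_img[OF Y.X_subset] Y.generate_X bij by (simp add: bij_betw_def)
  fix w assume w: "reduced w \<and> fst ` set w \<subseteq> \<phi> ` Y \<and> w \<noteq> []"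
  have inj: "inj_on \<phi> Y"
    using bij Y.X_subset by (auto simp: bij_betw_def inj_on_subset)
  let ?f = "\<lambda>l. (inv_into Y \<phi> (fst l), snd l)"
  have f: "?f l \<in> Y \<times> UNIV" "\<phi> (inv_into Y \<phi> (fst l)) = fst l" if "l \<in> set w" for l
  proof -
    have "fst l \<in> \<phi> ` Y"
      using w that by blast
    then show "?f l \<in> Y \<times> UNIV" "\<phi> (inv_into Y \<phi> (fst l)) = fst l"
      by (simp_all add: inv_into_into f_inv_into_f)
  qed
  have val: "\<phi> (word_val G (map ?f v)) = word_val G v" if "set v \<subseteq> set w" for v
    using that
  proof (induction v)
    case Nil
    show ?case
      unfolding list.map Y.wv_Nil by (rule \<phi>.hom_one)
  next
    case (Cons l v)
    have l: "l \<in> set w" and v: "set v \<subseteq> set w"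
      using Cons.prems by simp_all
    have lY: "?f l \<in> Y.letters"
      using f(1)[OF l] by (simp only: Y.letters_def)
    have vY: "set (map ?f v) \<subseteq> Y.letters"
      using f(1) v unfolding Y.letters_def by (simp only: set_map image_subset_iff) blast
    have "\<phi> (letter_val G (?f l)) = letter_val G l"
      using f[OF l] Y.X_subset unfolding letter_val_def
      by (cases "snd l") (auto simp: subset_iff)
    moreover have "\<phi> (word_val G (map ?f (l # v))) =
        \<phi> (letter_val G (?f l)) \<otimes> \<phi> (word_val G (map ?f v))"
      unfolding list.map Y.wv_Cons by (intro \<phi>.hom_mult Y.lv_closed Y.wv_closed lY vY)
    ultimately show ?case
      using Cons.IH[OF v] unfolding Y.wv_Cons by (simp only:)
  qed
  have red: "reduced (map ?f w)"
    unfolding reduced_def successively_map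
  proof (rule successively_mono)
    show "successively (\<lambda>l m. \<not> (fst l = fst m \<and> snd l \<noteq> snd m)) w"
      using w by (simp add: reduced_def)
    fix l m assume lm: "l \<in> set w" "m \<in> set w" "\<not> (fst l = fst m \<and> snd l \<noteq> snd m)"
    have "fst l = fst m" if "inv_into Y \<phi> (fst l) = inv_into Y \<phi> (fst m)"
      using arg_cong[OF that, of \<phi>] unfolding f(2)[OF lm(1)] f(2)[OF lm(2)] .
    with lm(3) show "\<not> (fst (?f l) = fst (?f m) \<and> snd (?f l) \<noteq> snd (?f m))"
      by auto
  qed
  have RW: "map ?f w \<in> Y.RW"
    using red f(1) by (auto simp: Y.RW_def Y.letters_def)
  have "map ?f w \<noteq> []"
    using w by simp
  then have ne: "word_val G (map ?f w) \<noteq> \<one>"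
    using Y.wv_eq_one[OF RW] by blast
  have "word_val G (map ?f w) \<in> carrier G"
    using Y.RW_letters[OF RW] by (rule Y.wv_closed)
  then have "\<phi> (word_val G (map ?f w)) \<noteq> \<phi> \<one>"
    by (rule inj_on_contraD[OF bij_betw_imp_inj_on[OF bij] ne _ one_closed])
  then show "word_val G w \<noteq> \<one>"
    using val[OF order_refl] by simp
qed

lemma (in group) primitive_iso:
  "\<phi> \<in> iso G G \<Longrightarrow> g \<in> primitive_words G \<Longrightarrow> \<phi> g \<in> primitive_words G"
  using free_basis_iso by (fastforce simp: primitive_words_def)

lemma (in group) primitive_carrier: "g \<in> primitive_words G \<Longrightarrow> g \<in> carrier G"
  by (auto simp: primitive_words_def free_basis_def)

lemma (in group) conj_iso:
  assumes h: "h \<in> carrier G"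
  shows "(\<lambda>x. inv h \<otimes> x \<otimes> h) \<in> iso G G"
proof -
  have inv1: "inv h \<otimes> (h \<otimes> x \<otimes> inv h) \<otimes> h = x" and inv2: "h \<otimes> (inv h \<otimes> x \<otimes> h) \<otimes> inv h = x"
    if "x \<in> carrier G" for x
  proof -
    have "inv h \<otimes> (h \<otimes> x \<otimes> inv h) \<otimes> h = (inv h \<otimes> h) \<otimes> x \<otimes> (inv h \<otimes> h)"
      using h that by (simp only: m_assoc m_closed inv_closed)
    then show "inv h \<otimes> (h \<otimes> x \<otimes> inv h) \<otimes> h = x"
      using h that by simp
    have "h \<otimes> (inv h \<otimes> x \<otimes> h) \<otimes> inv h = (h \<otimes> inv h) \<otimes> x \<otimes> (h \<otimes> inv h)"
      using h that by (simp only: m_assoc m_closed inv_closed)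
    then show "h \<otimes> (inv h \<otimes> x \<otimes> h) \<otimes> inv h = x"
      using h that by simp
  qed
  have "inv h \<otimes> (x \<otimes> y) \<otimes> h = (inv h \<otimes> x \<otimes> h) \<otimes> (inv h \<otimes> y \<otimes> h)"
    if "x \<in> carrier G" "y \<in> carrier G" for x y
  proof -
    have "(inv h \<otimes> x \<otimes> h) \<otimes> (inv h \<otimes> y \<otimes> h) = inv h \<otimes> x \<otimes> (h \<otimes> inv h) \<otimes> y \<otimes> h"
      using h that by (simp only: m_assoc m_closed inv_closed)
    then show ?thesis
      using h that by (simp add: m_assoc)
  qed
  then have "(\<lambda>x. inv h \<otimes> x \<otimes> h) \<in> hom G G"
    using h by (intro homI) simp_all
  moreover have "bij_betw (\<lambda>x. inv h \<otimes> x \<otimes> h) (carrier G) (carrier G)"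
    by (rule bij_betw_byWitness[where f' = "\<lambda>x. h \<otimes> x \<otimes> inv h"])
       (use h inv1 inv2 in auto)
  ultimately show ?thesis
    by (simp add: iso_def)
qed

section \<open>Whitehead's cut vertex lemma\<close>

lemma not_successivelyE:
  assumes "\<not> successively P xs"
  obtains p a b q where "xs = p @ a # b # q" "\<not> P a b"
  using assms
proof (induction xs arbitrary: thesis)
  case (Cons x xs)
  then have ne: "xs \<noteq> []" and disj: "\<not> P x (hd xs) \<or> \<not> successively P xs"
    by (auto simp: successively_Cons)
  show ?case
  proof (cases "P x (hd xs)")
    case True
    then obtain p a b q where "xs = p @ a # b # q" "\<not> P a b"
      using Cons.IH disj by blast
    then show ?thesis
      using Cons.prems(1)[of "x # p" a b q] by simp
  next
    case False
    then show ?thesis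
      using Cons.prems(1)[of "[]" x "hd xs" "tl xs"] ne by simp
  qed
qed simp

text \<open>Neighbouring letters of \<open>w @ w\<close> are neighbours on the cyclic word
  \<open>w\<close>, and the split rotates the word to that corner. For \<open>w1 = []\<close> the
  corner is the seam, which is why \<open>a\<close> is the last letter of \<open>w @ w1\<close> and
  not of \<open>w1\<close>.\<close>

lemma cyclic_split:
  assumes "w @ w = p @ a # b # q"
  obtains w1 w2 where "w = w1 @ w2" "w2 \<noteq> []" "hd w2 = b" "last (w @ w1) = a"
proof -
  have "w @ w = (p @ [a]) @ (b # q)"
    using assms by simp
  then obtain us where
    "w = (p @ [a]) @ us \<and> us @ w = b # q \<or> w @ us = p @ [a] \<and> w = us @ b # q"
    unfolding append_eq_append_conv2 by blast
  then show ?thesis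
  proof (elim disjE conjE)
    assume 1: "w = (p @ [a]) @ us" "us @ w = b # q"
    show ?thesis
    proof (cases "us = []")
      case True
      have "last w = a" "w \<noteq> []"
        using 1(1) True by simp_all
      moreover have "hd w = b"
        using 1(2) True by simp
      ultimately show ?thesis
        by (intro that[of "[]" w]) simp_all
    next
      case False
      then show ?thesis
        using 1 by (intro that[of "p @ [a]" us]) (auto simp: hd_append dest: arg_cong[of _ _ hd])
    qed
  next
    assume 2: "w @ us = p @ [a]" "w = us @ b # q"
    then show ?thesis
      by (intro that[of us "b # q"]) (simp_all only: last_snoc list.sel, auto)
  qed
qed

lemma infinite_if_lengths:
  fixes f :: "nat \<Rightarrow> 'a list"
  assumes "\<And>n. f n \<in> S" "\<And>n. length (f n) = a + n * b" "b > 0"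
  shows "infinite S"
proof -
  have "inj f"
    using assms(2,3) by (intro injI) (metis add_left_cancel mult_cancel2 not_gr_zero)
  then have "infinite (range f)"
    by (rule range_inj_infinite)
  moreover have "range f \<subseteq> S"
    using assms(1) by auto
  ultimately show ?thesis
    using finite_subset by blast
qed

text \<open>
  The Whitehead graph of a word has an edge from \<open>linv a\<close> to \<open>b\<close> for every pair of consecutive
  letters \<open>a b\<close>. The relation below says that this edge does not join \<open>Y\<close> to the complement
  of \<open>insert v Y\<close>.
\<close>

definition link :: "'a \<times> bool \<Rightarrow> ('a \<times> bool) set \<Rightarrow> 'a \<times> bool \<Rightarrow> 'a \<times> bool \<Rightarrow> bool" where
  "link v Y a b \<longleftrightarrow> (linv a \<in> Y \<and> b \<notin> Y \<longrightarrow> b = v) \<and> (b \<in> Y \<and> linv a \<notin> Y \<longrightarrow> linv a = v)"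

section \<open>Half-trees and their finite boundaries\<close>

context free_on begin

text \<open>For a letter \<open>l\<close> this is a half-tree: the part of the Cayley tree beyond
  the edge from \<open>\<one>\<close> to \<open>lv l\<close>.\<close>

definition start :: "'a \<times> bool \<Rightarrow> 'a set" where
  "start l = {g \<in> carrier G. rw g \<noteq> [] \<and> hd (rw g) = l}"

text \<open>Right multiplication by a letter alters only the end of the reduced word, so the first
  letter changes only along the edge between \<open>\<one>\<close> and \<open>lv l\<close>. The two
  cases are the two directions of this edge.\<close>

lemma start_mult_letter:
  assumes "g \<in> carrier G" "m \<in> letters" "(g \<in> start l) \<noteq> (g \<otimes> lv m \<in> start l)"
  shows "(g = \<one> \<and> m = l) \<or> (g = lv (linv m) \<and> linv m = l)"
proof (cases "rw g \<noteq> [] \<and> last (rw g) = linv m")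
  case True
  then have g: "rw g = butlast (rw g) @ [linv m]"
    by (metis append_butlast_last_id)
  have rw': "rw (g \<otimes> lv m) = butlast (rw g)"
    using assms True rw_mult_letter[of g m] by simp
  have "butlast (rw g) = []"
  proof (rule ccontr)
    assume "butlast (rw g) \<noteq> []"
    then have "hd (butlast (rw g)) = hd (rw g)"
      using g by (metis hd_append2)
    then show False
      using assms rw' True \<open>butlast (rw g) \<noteq> []\<close> by (auto simp: start_def)
  qed
  then have "rw g = [linv m]" "rw (g \<otimes> lv m) = []"
    using g rw' by auto
  then show ?thesis
    using assms wv_rw[of g] by (auto simp: start_def wv_Cons)
next
  case False
  then have rw': "rw (g \<otimes> lv m) = rw g @ [m]"
    using assms rw_mult_letter[of g m] by auto
  show ?thesis
  proof (cases "rw g = []")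
    case True
    then show ?thesis
      using assms rw' wv_rw[of g] by (auto simp: start_def)
  next
    case False
    then show ?thesis
      using assms rw' by (auto simp: start_def)
  qed
qed

text \<open>Along the path that spells \<open>h\<close>, each letter crosses the boundary edge for
  finitely many starting points only. A general \<open>h\<close> is allowed because the lemma will
  be applied to the letters of a different basis.\<close>

lemma finite_start_boundary:
  assumes "h \<in> carrier G"
  shows "finite {g \<in> carrier G. (g \<in> start l) \<noteq> (g \<otimes> h \<in> start l)}"
proof -
  have "finite {g \<in> carrier G. (g \<in> start l) \<noteq> (g \<otimes> wv w \<in> start l)}" if "set w \<subseteq> letters" for w
    using that
  proof (induction w)
    case Nil
    have "{g \<in> carrier G. (g \<in> start l) \<noteq> (g \<otimes> wv [] \<in> start l)} = {}"
      by auto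
    then show ?case by (metis finite.emptyI)
  next
    case (Cons m w)
    let ?B = "\<lambda>h. {g \<in> carrier G. (g \<in> start l) \<noteq> (g \<otimes> h \<in> start l)}"
    have m: "m \<in> letters" and w: "wv w \<in> carrier G"
      using Cons.prems by auto
    have "?B (wv (m # w)) \<subseteq> ?B (lv m) \<union> ((\<lambda>g. g \<otimes> lv m) -` ?B (wv w) \<inter> carrier G)"
      using m w by (auto simp: wv_Cons m_assoc)
    moreover have "?B (lv m) \<subseteq> {\<one>, lv (linv m)}"
      using start_mult_letter m by blast
    then have "finite (?B (lv m))"
      using finite_subset by blast
    moreover have "finite ((\<lambda>g. g \<otimes> lv m) -` ?B (wv w) \<inter> carrier G)"
      using Cons m by (intro finite_vimage_IntI inj_onI) auto
    ultimately show ?case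
      using finite_subset by blast
  qed
  from this[of "rw h"] show ?thesis
    using assms by (simp add: rw_letters)
qed

lemma RW_power:
  assumes "w \<in> RW" "reduced (w @ w)"
  shows "concat (replicate n w) \<in> RW"
proof (induction n)
  case (Suc n)
  then show ?case
    using assms by (cases n) (auto simp: RW_append_iff reduced_append)
qed simp

end

text \<open>Setting of an indirect proof: the cyclic Whitehead graph of \<open>w\<close>, read off
  \<open>w @ w\<close>, has no cut vertex, while \<open>C\<close> is invariant under
  \<open>wv w\<close> and has finite boundary. The outcome is \<open>finite_or_cofinite\<close>,
  which a half-tree of another basis contradicts.\<close>

locale invariant_set = free_on +
  fixes w :: "('a \<times> bool) list" and C :: "'a set"
  assumes finite_X: "finite X" and card_X: "card X \<ge> 2"
    and w_RW: "w \<in> RW" and w_ne: "w \<noteq> []" and w_cyc: "reduced (w @ w)"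
    and C_inv: "g \<in> carrier G \<Longrightarrow> g \<otimes> wv w \<in> C \<longleftrightarrow> g \<in> C"
    and C_boundary: "l \<in> letters \<Longrightarrow> finite {g \<in> carrier G. (g \<in> C) \<noteq> (g \<otimes> lv l \<in> C)}"
    and no_cut: "v \<in> letters \<Longrightarrow> Y \<subseteq> letters - {v} \<Longrightarrow> Y \<noteq> {} \<Longrightarrow> Y \<noteq> letters - {v} \<Longrightarrow>
      \<not> successively (link v Y) (w @ w)"
begin

abbreviation wpow :: "nat \<Rightarrow> ('a \<times> bool) list" where
  "wpow n \<equiv> concat (replicate n w)"

lemma wpow_RW: "wpow n \<in> RW"
  using w_RW w_cyc by (rule RW_power)

lemma length_wpow: "length (wpow n) = n * length w"
  by (induction n) auto

lemma wpow_Suc': "wpow (Suc n) = wpow n @ w"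
  by (induction n) auto

lemma hd_wpow: "n > 0 \<Longrightarrow> hd (wpow n) = hd w"
  using w_ne by (cases n) auto

lemma last_wpow: "n > 0 \<Longrightarrow> last (wpow n) = last w"
proof (induction n)
  case (Suc n)
  then show ?case
    using w_ne by (cases n) (auto simp: last_append)
qed simp

lemma hd_neq_linv_last: "hd w \<noteq> linv (last w)"
  using w_cyc w_ne by (simp add: reduced_append)

lemma C_inv_wpow: "g \<in> carrier G \<Longrightarrow> g \<otimes> wv (wpow n) \<in> C \<longleftrightarrow> g \<in> C"
proof (induction n arbitrary: g)
  case (Suc n)
  have sub: "set w \<subseteq> letters" "set (wpow n) \<subseteq> letters"
    using RW_letters[OF w_RW] RW_letters[OF wpow_RW[of n]] by blast+
  have "g \<otimes> wv (wpow (Suc n)) = (g \<otimes> wv w) \<otimes> wv (wpow n)"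
    using Suc.prems wv_append[OF sub] wv_closed[OF sub(1)] wv_closed[OF sub(2)]
    by (simp add: m_assoc)
  then show ?case
    using Suc C_inv w_RW by (simp add: RW_letters)
qed simp

text \<open>The elements \<open>wv (u @ x)\<close> form the cone of the tree below \<open>u\<close>;
  here almost all of the cone lies outside \<open>C\<close>, and for \<open>few_out\<close> inside
  \<open>C\<close>.\<close>

definition few_in :: "('a \<times> bool) list \<Rightarrow> bool" where
  "few_in u \<longleftrightarrow> finite {x. u @ x \<in> RW \<and> wv (u @ x) \<in> C}"

definition few_out :: "('a \<times> bool) list \<Rightarrow> bool" where
  "few_out u \<longleftrightarrow> finite {x. u @ x \<in> RW \<and> wv (u @ x) \<notin> C}"

text \<open>
  A translate of the axis of \<open>w\<close> runs from the cone below \<open>u @ [linv a]\<close> to the cone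
  below \<open>u @ [b]\<close>, and \<open>C\<close> contains all or none of its vertices.
\<close>

lemma axis:
  assumes "w @ w = p @ a # b # q" "u @ [b] \<in> RW" "u @ [linv a] \<in> RW"
  shows "(\<not> few_in (u @ [b]) \<and> \<not> few_in (u @ [linv a])) \<or>
    (\<not> few_out (u @ [b]) \<and> \<not> few_out (u @ [linv a]))"
proof -
  obtain w1 w2 where w12: "w = w1 @ w2" "w2 \<noteq> []" "hd w2 = b" "last (w @ w1) = a"
    using cyclic_split[OF assms(1)] .
  have RW12: "w1 \<in> RW" "w2 \<in> RW" and u: "u \<in> RW"
    using w_RW w12(1) assms(2) by (auto simp: RW_append_iff)
  let ?c = "wv (u @ w2) \<in> C"
  have c: "wv (u @ w2) \<in> carrier G"
    using u RW12 by (simp add: RW_letters)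
  \<comment> \<open>Forward ray of the axis: from \<open>u\<close> it reads \<open>w2\<close>, whose
    first letter is \<open>b\<close>, and then copies of \<open>w\<close>.\<close>
  define f where "f n = tl w2 @ wpow n" for n
  have bf: "b # f n = w2 @ wpow n" for n
    using w12(2,3) by (cases w2) (simp_all add: f_def)
  have f_RW: "(u @ [b]) @ f n \<in> RW" for n
  proof -
    have "w2 @ wpow n \<in> RW"
      using RW12 wpow_RW[of n] w12(1,2) hd_wpow[of n] hd_neq_linv_last
      by (cases n) (auto simp: RW_append_iff)
    then have "b # f n \<in> RW"
      by (simp only: bf)
    then show ?thesis
      using assms(2) by (auto simp: RW_append_iff RW_Cons_iff)
  qed
  have f_val: "wv ((u @ [b]) @ f n) \<in> C \<longleftrightarrow> ?c" for n
  proof -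
    have "wv ((u @ [b]) @ f n) = wv ((u @ w2) @ wpow n)"
      using bf[of n] by simp
    also have "\<dots> = wv (u @ w2) \<otimes> wv (wpow n)"
      using RW_letters[OF u] RW_letters[OF RW12(2)]
      by (intro wv_append RW_letters[OF wpow_RW]) simp
    finally show ?thesis
      using C_inv_wpow[OF c] by simp
  qed
  \<comment> \<open>Backward ray: from \<open>u\<close> it reads the inverse of \<open>z n\<close>.
    The full copies of \<open>w\<close> before \<open>w1\<close> ensure that \<open>z n\<close> ends
    with \<open>a\<close> even for \<open>w1 = []\<close>.\<close>
  define z where "z n = wpow (Suc n) @ w1" for n
  have last_z: "last (z n) = a" for n
    using w12(4) last_wpow[of "Suc n"] by (cases "w1 = []") (auto simp: z_def)
  have z_RW: "z n \<in> RW" for n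
    using RW12 wpow_RW[of "Suc n"] last_wpow[of "Suc n"] w12(1) hd_neq_linv_last
    unfolding z_def RW_append_iff by (cases "w1 = []") auto
  have z_ne: "z n \<noteq> []" for n
    using w_ne by (simp add: z_def)
  define h where "h n = tl (winv (z n))" for n
  have ah: "linv a # h n = winv (z n)" for n
    using hd_winv[OF z_ne[of n]] last_z[of n] z_ne[of n]
    by (metis h_def list.collapse winv_simps(5))
  have h_RW: "(u @ [linv a]) @ h n \<in> RW" for n
  proof -
    have "linv a # h n \<in> RW"
      unfolding ah using z_RW by simp
    then show ?thesis
      using assms(3) by (auto simp: RW_append_iff RW_Cons_iff)
  qed
  have h_val: "wv ((u @ [linv a]) @ h n) \<in> C \<longleftrightarrow> ?c" for n
  proof -
    let ?g = "wv u \<otimes> inv (wv (z n))"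
    have z_lett: "set (z n) \<subseteq> letters"
      using z_RW by (rule RW_letters)
    have cl: "wv u \<in> carrier G" "wv (z n) \<in> carrier G" "wv w2 \<in> carrier G" "?g \<in> carrier G"
      using u RW12 z_lett by (simp_all add: RW_letters)
    have "wv ((u @ [linv a]) @ h n) = wv (u @ winv (z n))"
      using ah[of n] by simp
    also have "\<dots> = ?g"
      using u z_lett by (simp add: wv_append RW_letters wv_winv)
    finally have 1: "wv ((u @ [linv a]) @ h n) = ?g" .
    \<comment> \<open>Since \<open>z n @ w2\<close> is a power of \<open>w\<close>, multiplication
      by this power carries the point on the backward ray to \<open>wv (u @ w2)\<close>.\<close>
    have "wv (wpow (Suc (Suc n))) = wv (z n @ w2)"
      unfolding z_def wpow_Suc'[of "Suc n"] append_assoc w12(1)[symmetric] ..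
    also have "\<dots> = wv (z n) \<otimes> wv w2"
      using z_lett RW12 by (simp add: wv_append RW_letters)
    finally have "?g \<otimes> wv (wpow (Suc (Suc n))) = wv u \<otimes> wv w2"
      using cl by (simp add: m_assoc inv_solve_left')
    also have "\<dots> = wv (u @ w2)"
      using u RW12 by (simp add: wv_append RW_letters)
    finally show ?thesis
      using C_inv_wpow[OF cl(4), of "Suc (Suc n)"] 1 by simp
  qed
  have len_f: "length (f n) = (length w2 - 1) + n * length w" for n
    by (simp add: f_def length_wpow)
  have len_h: "length (h n) = (length w + length w1 - 1) + n * length w" for n
  proof -
    have "length (h n) = (Suc n * length w + length w1) - 1"
      unfolding h_def z_def by (simp only: length_tl winv_simps(4) length_append length_wpow)
    moreover have "length w \<ge> 1"
      using w_ne by (simp add: Suc_le_eq)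
    ultimately show ?thesis
      by simp
  qed
  show ?thesis
  proof (cases ?c)
    case True
    have "\<not> few_in (u @ [b])"
      unfolding few_in_def
      by (rule infinite_if_lengths[OF _ len_f]) (use f_RW f_val True w_ne in auto)
    moreover have "\<not> few_in (u @ [linv a])"
      unfolding few_in_def
      by (rule infinite_if_lengths[OF _ len_h]) (use h_RW h_val True w_ne in auto)
    ultimately show ?thesis by simp
  next
    case False
    have "\<not> few_out (u @ [b])"
      unfolding few_out_def
      by (rule infinite_if_lengths[OF _ len_f]) (use f_RW f_val False w_ne in auto)
    moreover have "\<not> few_out (u @ [linv a])"
      unfolding few_out_def
      by (rule infinite_if_lengths[OF _ len_h]) (use h_RW h_val False w_ne in auto)
    ultimately show ?thesis by simp
  qed
qed

lemma finite_letters: "finite letters"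
  using finite_X by (simp add: letters_def)

lemma card_letters: "card letters \<ge> 4"
  using card_X by (simp add: letters_def card_cartesian_product)

text \<open>The cone below \<open>u\<close> consists of \<open>u\<close> itself and the cones below
  its finitely many children.\<close>

lemma few_step:
  assumes "\<And>b. u @ [b] \<in> RW \<Longrightarrow> finite {x. (u @ [b]) @ x \<in> RW \<and> R ((u @ [b]) @ x)}"
  shows "finite {x. u @ x \<in> RW \<and> R (u @ x)}"
proof -
  let ?D = "{b. u @ [b] \<in> RW}"
  have "?D \<subseteq> letters"
    by (auto simp: RW_append_iff RW_Cons_iff)
  then have "finite ?D"
    using finite_letters finite_subset by blast
  then have "finite (insert [] (\<Union>b\<in>?D. (#) b ` {x. (u @ [b]) @ x \<in> RW \<and> R ((u @ [b]) @ x)}))"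
    using assms by auto
  moreover have "{x. u @ x \<in> RW \<and> R (u @ x)} \<subseteq>
      insert [] (\<Union>b\<in>?D. (#) b ` {x. (u @ [b]) @ x \<in> RW \<and> R ((u @ [b]) @ x)})"
  proof
    fix x assume x: "x \<in> {x. u @ x \<in> RW \<and> R (u @ x)}"
    show "x \<in> insert [] (\<Union>b\<in>?D. (#) b ` {x. (u @ [b]) @ x \<in> RW \<and> R ((u @ [b]) @ x)})"
    proof (cases x)
      case (Cons b y)
      then have "u @ [b] \<in> RW" "(u @ [b]) @ y \<in> RW \<and> R ((u @ [b]) @ y)"
        using x by (auto simp: RW_append_iff RW_Cons_iff)
      then show ?thesis
        using Cons by blast
    qed simp
  qed
  ultimately show ?thesis
    using finite_subset by blast
qed

text \<open>Otherwise the children fall into two nonempty classes: those whose cones meet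
  \<open>C\<close> infinitely often, and those whose cones do not. Without a cut vertex some edge of
  the Whitehead graph joins the two classes, and the axis that passes through \<open>u\<close> along
  this edge puts both of its ends into the same class.\<close>

lemma cone_step:
  assumes u: "u \<in> RW" and children: "\<And>b. u @ [b] \<in> RW \<Longrightarrow> few_in (u @ [b]) \<or> few_out (u @ [b])"
  shows "few_in u \<or> few_out u"
proof (rule ccontr)
  assume neg: "\<not> (few_in u \<or> few_out u)"
  let ?D = "{b. u @ [b] \<in> RW}"
  define Y where "Y = {b \<in> ?D. \<not> few_in (u @ [b])}"
  have D_letters: "?D \<subseteq> letters"
    by (auto simp: RW_append_iff RW_Cons_iff)
  have "Y \<noteq> {}"
  proof
    assume "Y = {}"
    then have "few_in (u @ [b])" if "u @ [b] \<in> RW" for b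
      using that Y_def by blast
    then have "few_in u"
      unfolding few_in_def by (rule few_step[where R = "\<lambda>x. wv x \<in> C"])
    with neg show False by simp
  qed
  have "Y \<noteq> ?D"
  proof
    assume "Y = ?D"
    then have "few_out (u @ [b])" if "u @ [b] \<in> RW" for b
      using that children Y_def by blast
    then have "few_out u"
      unfolding few_out_def by (rule few_step[where R = "\<lambda>x. wv x \<notin> C"])
    with neg show False by simp
  qed
  \<comment> \<open>Below a nonempty \<open>u\<close> the vertex to delete is the direction back to
    the parent. At the root all letters are directions, and \<open>v\<close> only has to leave both
    classes nonempty; four letters suffice for that.\<close>
  obtain v where v: "v \<in> letters" "Y - {v} \<noteq> {}" "Y - {v} \<noteq> letters - {v}" "letters - {v} \<subseteq> ?D"
  proof (cases "u = []")
    case False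
    have D: "?D = letters - {linv (last u)}"
      using False u by (auto simp: RW_append_iff RW_Cons_iff)
    have "last u \<in> letters"
      using False RW_letters[OF u] by auto
    moreover have "linv (last u) \<notin> Y"
      using D unfolding Y_def by blast
    ultimately show ?thesis
      using D \<open>Y \<noteq> {}\<close> \<open>Y \<noteq> ?D\<close> by (intro that[of "linv (last u)"]) auto
  next
    case True
    then have D: "?D = letters"
      by (auto simp: RW_Cons_iff)
    have Ysub: "Y \<subseteq> letters" "Y \<noteq> letters"
      using D \<open>Y \<noteq> ?D\<close> unfolding Y_def by auto
    show ?thesis
    proof (cases "\<exists>y. Y = {y}")
      case False
      then obtain y where "y \<in> Y" "Y - {y} \<noteq> {}"
        using \<open>Y \<noteq> {}\<close> by blast
      then show ?thesis
        using Ysub D by (intro that[of y]) auto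
    next
      case True
      then obtain y where y: "Y = {y}" by blast
      have "card (letters - {y}) \<ge> 3"
        using card_letters y Ysub by (simp add: card_Diff_singleton)
      then have "\<not> card (letters - {y}) \<le> Suc 0"
        by simp
      then obtain z1 z2 where z: "z1 \<in> letters - {y}" "z2 \<in> letters - {y}" "z1 \<noteq> z2"
        using card_le_Suc0_iff_eq[OF finite_Diff[OF finite_letters]] by blast
      then show ?thesis
        using y D by (intro that[of z1]) auto
    qed
  qed
  have "Y - {v} \<subseteq> letters - {v}"
    using D_letters unfolding Y_def by blast
  then have "\<not> successively (link v (Y - {v})) (w @ w)"
    using no_cut v by blast
  then obtain p a b q where ab: "w @ w = p @ a # b # q" "\<not> link v (Y - {v}) a b"
    by (rule not_successivelyE)
  have "set (w @ w) \<subseteq> letters"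
    using RW_letters[OF w_RW] by simp
  then have "a \<in> letters" "b \<in> letters"
    unfolding ab(1) by simp_all
  moreover have "b \<noteq> v" "linv a \<noteq> v" and ne: "(linv a \<in> Y) \<noteq> (b \<in> Y)"
    using ab(2) unfolding link_def by blast+
  ultimately have "b \<in> letters - {v}" "linv a \<in> letters - {v}"
    by simp_all
  then have D: "b \<in> ?D" "linv a \<in> ?D"
    using v(4) by blast+
  from axis[OF ab(1)] D have "few_in (u @ [b]) \<longleftrightarrow> few_in (u @ [linv a])"
    using children by blast
  with ne D show False
    unfolding Y_def by blast
qed

text \<open>Every cone beyond the boundary of \<open>C\<close> lies inside \<open>C\<close> or
  misses it. \<open>cone_step\<close> carries the dichotomy from there back to the empty word, whose
  cone is the whole group.\<close>

lemma finite_or_cofinite: "finite C \<or> finite (carrier G - C)" if "C \<subseteq> carrier G"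
proof -
  let ?B = "\<Union>l\<in>letters. {g \<in> carrier G. (g \<in> C) \<noteq> (g \<otimes> lv l \<in> C)}"
  have "finite ?B"
    using finite_letters C_boundary by blast
  then obtain N where N: "\<And>g. g \<in> ?B \<Longrightarrow> len g \<le> N"
    using finite_nat_set_iff_bounded_le[of "len ` ?B"] by blast
  have far: "wv (u @ x) \<in> C \<longleftrightarrow> wv u \<in> C" if "length u > N" "u @ x \<in> RW" for u x
    using that(2)
  proof (induction x rule: rev_induct)
    case (snoc l x)
    have *: "u @ x \<in> RW" "l \<in> letters"
      using snoc.prems by (auto simp: RW_append_iff RW_Cons_iff)
    have "len (wv (u @ x)) > N"
      using * that(1) by (simp add: len_def)
    then have "wv (u @ x) \<notin> ?B"
      using N[of "wv (u @ x)"] by linarith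
    moreover have "wv (u @ x) \<in> carrier G"
      by (rule wv_closed[OF RW_letters[OF *(1)]])
    ultimately have "wv (u @ x) \<in> C \<longleftrightarrow> wv (u @ x) \<otimes> lv l \<in> C"
      using *(2) by blast
    also have "wv (u @ x) \<otimes> lv l = wv ((u @ x) @ [l])"
      using wv_append[of "u @ x" "[l]"] RW_letters[OF *(1)] *(2) by simp
    finally show ?case
      using snoc.IH * by simp
  qed simp
  have "few_in u \<or> few_out u" if "u \<in> RW" for u
    using that
  proof (induction "Suc N - length u" arbitrary: u rule: less_induct)
    case less
    show ?case
    proof (cases "length u > N")
      case True
      show ?thesis
      proof (cases "wv u \<in> C")
        case True
        then have "{x. u @ x \<in> RW \<and> wv (u @ x) \<notin> C} = {}"
          using far[OF \<open>length u > N\<close>] by blast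
        then show ?thesis
          unfolding few_out_def by (metis finite.emptyI)
      next
        case False
        then have "{x. u @ x \<in> RW \<and> wv (u @ x) \<in> C} = {}"
          using far[OF \<open>length u > N\<close>] by blast
        then show ?thesis
          unfolding few_in_def by (metis finite.emptyI)
      qed
    next
      case False
      then show ?thesis
        using less.hyps[of "u @ [_]"] by (intro cone_step[OF less.prems]) simp
    qed
  qed
  from this[of "[]"] have "finite {x \<in> RW. wv x \<in> C} \<or> finite {x \<in> RW. wv x \<notin> C}"
    by (simp add: few_in_def few_out_def)
  moreover have sub: "S \<subseteq> wv ` {x \<in> RW. wv x \<in> S}" if "S \<subseteq> carrier G" for S
  proof
    fix g assume "g \<in> S"
    then show "g \<in> wv ` {x \<in> RW. wv x \<in> S}"
      using that by (intro image_eqI[of _ _ "rw g"]) auto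
  qed
  have "C \<subseteq> wv ` {x \<in> RW. wv x \<in> C}" "carrier G - C \<subseteq> wv ` {x \<in> RW. wv x \<notin> C}"
    using sub[OF that] sub[of "carrier G - C"] by blast+
  ultimately show ?thesis
    by (meson finite_imageI finite_subset)
qed

end

section \<open>A half-tree of a second basis as the invariant set\<close>

context free_on begin

text \<open>A basis with one element would make the group cyclic, hence abelian, but
  \<open>x y\<close> and \<open>y x\<close> are different reduced words over
  \<open>X\<close>.\<close>

lemma basis_not_singleton:
  assumes "card X \<ge> 2" "free_basis G Y" "g \<in> Y"
  shows "\<exists>h \<in> Y. h \<noteq> g"
proof (rule ccontr)
  assume "\<not> (\<exists>h \<in> Y. h \<noteq> g)"
  then have Y: "Y = {g}"
    using assms(3) by blast
  then have g: "g \<in> carrier G" and gen: "generate G {g} = carrier G"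
    using assms(2) by (auto simp: free_basis_def)
  obtain x y where xy: "x \<in> X" "y \<in> X" "x \<noteq> y"
    using assms(1) by (metis card_le_Suc0_iff_eq card.infinite not_less_eq_eq numeral_2_eq_2 zero_le)
  have pw: "\<exists>k::int. h = g [^] k" if "h \<in> X" for h
  proof -
    have "h \<in> generate G {g}"
      using that X_subset gen by blast
    then show ?thesis
      unfolding generate_pow[OF g] by blast
  qed
  obtain i j :: int where ij: "x = g [^] i" "y = g [^] j"
    using pw[OF xy(1)] pw[OF xy(2)] by blast
  have "x \<otimes> y = y \<otimes> x"
    unfolding ij using g by (simp add: int_pow_mult[symmetric] add.commute)
  moreover have "[(x, True), (y, True)] \<in> RW" "[(y, True), (x, True)] \<in> RW"
    using xy by (auto simp: RW_Cons_iff letters_def linv_Pair)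
  moreover have "wv [(x, True), (y, True)] = x \<otimes> y" "wv [(y, True), (x, True)] = y \<otimes> x"
    using xy X_subset by (auto simp: wv_Cons letter_val_def)
  ultimately have "[(x, True), (y, True)] = [(y, True), (x, True)]"
    using wv_inj by metis
  with xy show False by simp
qed

text \<open>The elements \<open>h g^n\<close> lie in the half-tree and the powers \<open>g^n\<close>
  outside it.\<close>

lemma infinite_start:
  assumes "h \<in> X" "g \<in> X" "h \<noteq> g"
  shows "infinite (start (h, True))" "infinite (carrier G - start (h, True))"
proof -
  have RW: "replicate n (g, True) \<in> RW" "(h, True) # replicate n (g, True) \<in> RW" for n
  proof -
    show *: "replicate n (g, True) \<in> RW"
      using assms by (induction n) (auto simp: RW_Cons_iff letters_def linv_Pair)
    show "(h, True) # replicate n (g, True) \<in> RW"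
      using assms * by (auto simp: RW_Cons_iff letters_def linv_Pair)
  qed
  have inj1: "inj (\<lambda>n. wv (replicate n (g, True)))"
    using wv_inj[OF RW(1) RW(1)] by (intro injI) (metis length_replicate)
  have inj2: "inj (\<lambda>n. wv ((h, True) # replicate n (g, True)))"
    using wv_inj[OF RW(2) RW(2)] by (intro injI) (metis length_replicate list.inject)
  have "wv ((h, True) # replicate n (g, True)) \<in> start (h, True)" for n
    using RW(2)[of n] wv_closed[OF RW_letters[OF RW(2)[of n]]] by (simp add: start_def)
  then have "range (\<lambda>n. wv ((h, True) # replicate n (g, True))) \<subseteq> start (h, True)"
    by blast
  then show "infinite (start (h, True))"
    using range_inj_infinite[OF inj2] finite_subset by blast
  have "wv (replicate n (g, True)) \<in> carrier G - start (h, True)" for n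
    using RW(1)[of n] wv_closed[OF RW_letters[OF RW(1)[of n]]] assms(3)
    by (cases n) (simp_all add: start_def)
  then have "range (\<lambda>n. wv (replicate n (g, True))) \<subseteq> carrier G - start (h, True)"
    by blast
  then show "infinite (carrier G - start (h, True))"
    using range_inj_infinite[OF inj1] finite_subset by blast
qed

text \<open>If there were no cut vertex, the half-tree at \<open>h\<close> over a basis containing
  \<open>g\<close> and \<open>h\<close> would be finite or cofinite.\<close>

theorem cut_vertex:
  assumes fin: "finite X" and card: "card X \<ge> 2"
    and g: "g \<in> primitive_words G" and cyc: "reduced (rw g @ rw g)"
  shows "\<exists>v Y. v \<in> letters \<and> Y \<subseteq> letters - {v, linv v} \<and> Y \<noteq> {} \<and> successively (link v Y) (rw g)"
proof -
  obtain B where B: "free_basis G B" "g \<in> B"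
    using g by (auto simp: primitive_words_def)
  interpret B: free_on G B
    using B(1) by unfold_locales
  obtain h where h: "h \<in> B" "h \<noteq> g"
    using basis_not_singleton[OF card B] by blast
  have gc: "g \<in> carrier G"
    using g by (rule primitive_carrier)
  have g_letter: "(g, True) \<in> B.letters" "letter_val G (g, True) = g"
    using B(2) by (auto simp: B.letters_def letter_val_def)
  let ?C = "B.start (h, True)"
  have "?C \<subseteq> carrier G"
    by (auto simp: B.start_def)
  have "rw g \<noteq> []"
    using B.rw_lv[OF g_letter(1)] gc g_letter(2) B.rw_one by (metis list.distinct(1) wv_Nil wv_rw)
  have "\<exists>v Y. v \<in> letters \<and> Y \<subseteq> letters - {v} \<and> Y \<noteq> {} \<and> Y \<noteq> letters - {v} \<and>
      successively (link v Y) (rw g @ rw g)"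
  proof (rule ccontr)
    assume no: "\<not> ?thesis"
    interpret invariant_set G X "rw g" ?C
    proof unfold_locales
      fix k assume k: "k \<in> carrier G"
      \<comment> \<open>The boundary edge of the half-tree is labelled \<open>h\<close>, so
        multiplication by \<open>g\<close> never crosses it.\<close>
      have "\<not> (k \<in> ?C) \<noteq> (k \<otimes> letter_val G (g, True) \<in> ?C)"
        using B.start_mult_letter[OF k g_letter(1), of "(h, True)"] h(2) by (auto simp: linv_Pair)
      then show "k \<otimes> wv (rw g) \<in> ?C \<longleftrightarrow> k \<in> ?C"
        using gc g_letter(2) by simp
    next
      fix l assume "l \<in> letters"
      then show "finite {k \<in> carrier G. (k \<in> ?C) \<noteq> (k \<otimes> lv l \<in> ?C)}"
        by (intro B.finite_start_boundary) simp
    qed (use fin card rw_RW[OF gc] cyc no \<open>rw g \<noteq> []\<close> in blast)+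
    show False
      using finite_or_cofinite[OF \<open>?C \<subseteq> carrier G\<close>] B.infinite_start[OF h(1) B(2) h(2)] by blast
  qed
  then obtain v Y where v: "v \<in> letters" and Y: "Y \<subseteq> letters - {v}" "Y \<noteq> {}" "Y \<noteq> letters - {v}"
    and succ: "successively (link v Y) (rw g @ rw g)" by blast
  have succ': "successively (link v Y) (rw g)"
    using succ by (simp add: successively_append_iff)
  show ?thesis
  proof (cases "linv v \<in> Y")
    case False
    then show ?thesis
      using v Y succ' by blast
  next
    case True
    \<comment> \<open>The other side of the cut avoids \<open>linv v\<close>, and on letters
      \<open>link\<close> is symmetric under exchanging the two sides.\<close>
    let ?Y = "letters - {v} - Y"
    have "successively (link v ?Y) (rw g)"
    proof (rule successively_mono[OF succ'])
      fix a b assume "a \<in> set (rw g)" "b \<in> set (rw g)" "link v Y a b"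
      moreover from this have "linv a \<in> letters" "b \<in> letters"
        using rw_letters[OF gc] by auto
      ultimately show "link v ?Y a b"
        unfolding link_def by blast
    qed
    then show ?thesis
      using v Y True by (intro exI[of _ v] exI[of _ ?Y]) blast
  qed
qed

end

section \<open>Whitehead automorphisms\<close>

text \<open>
  Edges of the Whitehead graph between \<open>Y\<close> and its complement, with multiplicity; the edge that
  closes up the cyclic word is left out.
\<close>

fun cross :: "('a \<times> bool) set \<Rightarrow> ('a \<times> bool) list \<Rightarrow> nat" where
  "cross Y [] = 0"
| "cross Y [a] = 0"
| "cross Y (a # b # w) = (if (linv a \<in> Y) = (b \<in> Y) then 0 else 1) + cross Y (b # w)"

context free_on begin

definition wh_prefix :: "'a \<times> bool \<Rightarrow> ('a \<times> bool) set \<Rightarrow> 'a \<times> bool \<Rightarrow> 'a" where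
  "wh_prefix v Y l = (if l \<in> Y then lv v else \<one>)"

text \<open>Whitehead automorphism of the cut. Between consecutive letters \<open>a b\<close> the
  image has the factor \<open>inv (wh_prefix v Y (linv a)) \<otimes> wh_prefix v Y b\<close>, which
  is trivial when \<open>linv a\<close> and \<open>b\<close> lie on the same side.\<close>

definition wh :: "'a \<times> bool \<Rightarrow> ('a \<times> bool) set \<Rightarrow> 'a \<times> bool \<Rightarrow> 'a" where
  "wh v Y l = wh_prefix v Y l \<otimes> lv l \<otimes> inv (wh_prefix v Y (linv l))"

lemma wh_prefix_closed [simp]: "v \<in> letters \<Longrightarrow> wh_prefix v Y l \<in> carrier G"
  by (simp add: wh_prefix_def)

lemma wh_closed [simp]: "v \<in> letters \<Longrightarrow> l \<in> letters \<Longrightarrow> wh v Y l \<in> carrier G"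
  by (simp add: wh_def)

lemma wh_linv: "v \<in> letters \<Longrightarrow> l \<in> letters \<Longrightarrow> wh v Y (linv l) = inv (wh v Y l)"
  by (simp add: wh_def inv_mult_group m_assoc)

context
  fixes v Y
  assumes v: "v \<in> letters" and Y: "Y \<subseteq> letters - {v, linv v}"
begin

lemma wh_self: "wh v Y v = lv v"
  using v Y by (auto simp: wh_def wh_prefix_def)

lemma wh_hom: "ext (wh v Y) \<in> hom G G"
  using v by (intro ext_hom wh_linv) auto

lemma ext_wh_lv: "l \<in> letters \<Longrightarrow> ext (wh v Y) (lv l) = wh v Y l"
  using v by (intro ext_lv wh_linv) auto

text \<open>Neither \<open>v\<close> nor \<open>linv v\<close> lies in \<open>Y\<close>, so
  \<open>ext (wh v Y)\<close> fixes \<open>lv v\<close>. It therefore turns every prefix for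
  \<open>linv v\<close> into the inverse of its own prefix, and the two cancel.\<close>

lemma wh_inverse:
  assumes l: "l \<in> letters"
  shows "ext (wh v Y) (ext (wh (linv v) Y) (lv l)) = lv l"
proof -
  interpret \<phi>: group_hom G G "ext (wh v Y)"
    using wh_hom by unfold_locales
  have "ext (wh (linv v) Y) (lv l) = wh (linv v) Y l"
    using v l by (intro ext_lv wh_linv) auto
  moreover have pre: "ext (wh v Y) (wh_prefix (linv v) Y m) = inv (wh_prefix v Y m)" for m
    using v wh_self ext_wh_lv[OF v] by (simp add: wh_prefix_def)
  ultimately have "ext (wh v Y) (ext (wh (linv v) Y) (lv l)) =
      inv (wh_prefix v Y l) \<otimes> wh v Y l \<otimes> wh_prefix v Y (linv l)"
    using v l ext_wh_lv[OF l] by (simp add: wh_def[of "linv v"])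
  also have "\<dots> = lv l"
  proof -
    have "inv (wh_prefix v Y l) \<otimes> wh v Y l \<otimes> wh_prefix v Y (linv l) =
        (inv (wh_prefix v Y l) \<otimes> wh_prefix v Y l) \<otimes> lv l \<otimes>
        (inv (wh_prefix v Y (linv l)) \<otimes> wh_prefix v Y (linv l))"
      unfolding wh_def using v l by (simp only: m_assoc m_closed wh_prefix_closed inv_closed lv_closed)
    then show ?thesis
      using v l by simp
  qed
  finally show ?thesis .
qed

text \<open>Once the leading prefix is removed, each letter contributes at most 1, each crossing
  saves 1, and the final \<open>+ 1\<close> pays for the inverse prefix after the last letter. The
  second claim, for words that begin with \<open>v\<close>, is carried along because a crossing into
  \<open>v\<close> deletes this \<open>v\<close>.\<close>

lemma wh_length_aux:
  assumes "set w \<subseteq> letters" "successively (link v Y) w" "w \<noteq> []"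
  shows "len (inv (wh_prefix v Y (hd w)) \<otimes> word_prod G (wh v Y) w) + cross Y w \<le> length w + 1 \<and>
    (hd w = v \<longrightarrow> len (word_prod G (wh v Y) (tl w)) + cross Y w \<le> length w)"
  using assms
proof (induction w)
  case (Cons a w)
  let ?p = "wh_prefix v Y" and ?W = "word_prod G (wh v Y)"
  have a: "a \<in> letters" and w: "set w \<subseteq> letters"
    using Cons.prems by auto
  have W_closed: "?W u \<in> carrier G" if "set u \<subseteq> letters" for u
    using that v by (intro word_prod_closed wh_closed) auto
  have first: "inv (?p a) \<otimes> ?W (a # w) = lv a \<otimes> (inv (?p (linv a)) \<otimes> ?W w)"
  proof -
    have "inv (?p a) \<otimes> ?W (a # w) =
        (inv (?p a) \<otimes> ?p a) \<otimes> (lv a \<otimes> (inv (?p (linv a)) \<otimes> ?W w))"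
      unfolding word_prod_Cons wh_def[of v Y a]
      using v a W_closed[OF w] by (simp only: m_assoc m_closed wh_prefix_closed inv_closed lv_closed)
    then show ?thesis
      using v a W_closed[OF w] by simp
  qed
  have p_le: "len (inv (?p l)) \<le> 1" for l
    using v len_lv[of "linv v"] by (simp add: wh_prefix_def len_def)
  show ?case
  proof (cases w)
    case Nil
    have "len (lv a \<otimes> inv (?p (linv a))) \<le> 2"
      using len_mult_le[of "lv a" "inv (?p (linv a))"] p_le[of "linv a"] a v by simp
    then show ?thesis
      using first Nil a v by (simp add: len_def)
  next
    case (Cons b u)
    let ?T = "inv (?p b) \<otimes> ?W w"
    have b: "b \<in> letters" and u: "set u \<subseteq> letters" and ne: "w \<noteq> []"
      using w Cons by auto
    have lk: "link v Y a b" and succ: "successively (link v Y) w"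
      using Cons.prems Cons by auto
    have IH1: "len ?T + cross Y w \<le> length w + 1"
      and IH2: "b = v \<Longrightarrow> len (?W u) + cross Y w \<le> length w"
      using Cons.IH[OF w succ ne] Cons by auto
    have T: "?T \<in> carrier G"
      using v W_closed[OF w] by simp
    have W_eq: "?W w = ?p b \<otimes> ?T"
      using v W_closed[OF w] by (simp add: m_assoc[symmetric])
    have "len (lv a \<otimes> (inv (?p (linv a)) \<otimes> ?W w)) + cross Y (a # w) \<le> length (a # w) + 1"
    proof -
      \<comment> \<open>By \<open>link\<close>, a crossing edge has \<open>v\<close> as one of its
        ends.\<close>
      consider (eq) "(linv a \<in> Y) = (b \<in> Y)" | (left) "b \<in> Y" "linv a \<notin> Y" "linv a = v"
        | (right) "linv a \<in> Y" "b \<notin> Y" "b = v"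
        using lk unfolding link_def by blast
      then show ?thesis
      proof cases
        case eq
        then have "?p (linv a) = ?p b"
          by (simp add: wh_prefix_def)
        then show ?thesis
          using len_mult_le[of "lv a" ?T] a T eq IH1 Cons by simp
      next
        \<comment> \<open>Here \<open>a\<close> is \<open>linv v\<close> and cancels the prefix of
          \<open>b\<close>.\<close>
        case left
        then have "lv a = inv (?p b)"
          using a by (metis inv_inv linv_linv lv_closed lv_linv wh_prefix_def)
        moreover have "?p (linv a) = \<one>"
          using left by (simp add: wh_prefix_def)
        ultimately have "lv a \<otimes> (inv (?p (linv a)) \<otimes> ?W w) = ?T"
          using W_closed[OF w] by simp
        then show ?thesis
          using IH1 left Cons by simp
      next
        \<comment> \<open>The inverse prefix after \<open>a\<close> cancels the letter
          \<open>b = v\<close>, so the second claim of the induction hypothesis applies to the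
          rest.\<close>
        case right
        have "?W w = lv v \<otimes> ?W u"
          using Cons right wh_self by simp
        moreover have "?p (linv a) = lv v"
          using right by (simp add: wh_prefix_def)
        ultimately have "inv (?p (linv a)) \<otimes> ?W w = ?W u"
          using v W_closed[OF u] by (simp add: m_assoc[symmetric])
        then show ?thesis
          using len_mult_le[of "lv a" "?W u"] a W_closed[OF u] IH2 right Cons by simp
      qed
    qed
    \<comment> \<open>No crossing can follow the letter \<open>v\<close>: with \<open>linv v\<close>
      outside \<open>Y\<close>, it would require \<open>linv v = v\<close>.\<close>
    moreover have "len (?W w) + cross Y (a # w) \<le> length (a # w)" if "a = v"
    proof -
      have 1: "linv a \<notin> Y"
        using that Y by blast
      then have 2: "b \<notin> Y"
        using that lk linv_neq(1)[of v] unfolding link_def by blast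
      from 1 2 have "?p b = \<one>" "cross Y (a # w) = cross Y w"
        using Cons by (simp_all add: wh_prefix_def)
      then show ?thesis
        using IH1 W_closed[OF w] by simp
    qed
    ultimately show ?thesis
      using first by simp
  qed
qed simp

text \<open>The slack of 2 stands for the prefix of the first letter and the inverse prefix after
  the last one.\<close>

lemma wh_length:
  assumes "g \<in> carrier G" "successively (link v Y) (rw g)"
  shows "len (ext (wh v Y) g) + cross Y (rw g) \<le> len g + 2"
proof (cases "rw g = []")
  case True
  then show ?thesis
    by (simp add: ext_def len_def)
next
  case False
  let ?p = "wh_prefix v Y (hd (rw g))" and ?W = "word_prod G (wh v Y) (rw g)"
  have W: "?W \<in> carrier G"
    using v assms(1) rw_letters by (intro word_prod_closed wh_closed) auto
  have "len ?p \<le> 1"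
    using v by (simp add: wh_prefix_def len_def[of \<one>])
  moreover have "?p \<otimes> (inv ?p \<otimes> ?W) = ?W"
    using v W by (simp add: m_assoc[symmetric])
  ultimately have "len ?W \<le> 1 + len (inv ?p \<otimes> ?W)"
    using len_mult_le[of ?p "inv ?p \<otimes> ?W"] v W by simp
  then show ?thesis
    using wh_length_aux[of "rw g"] assms rw_letters[OF assms(1)] False
    by (simp add: ext_def len_def[of g])
qed

end

lemma wh_iso:
  assumes "v \<in> letters" "Y \<subseteq> letters - {v, linv v}"
  shows "ext (wh v Y) \<in> iso G G"
proof -
  have v': "linv v \<in> letters" "Y \<subseteq> letters - {linv v, linv (linv v)}"
    using assms by auto
  have x: "(x, True) \<in> letters" "lv (x, True) = x" if "x \<in> X" for x
    using that by (auto simp: letters_def letter_val_def)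
  show ?thesis
  proof (rule isoI_inverse[OF wh_hom[OF assms] wh_hom[OF v']])
    fix y assume "y \<in> X"
    from x[OF this] show "ext (wh v Y) (ext (wh (linv v) Y) y) = y"
      "ext (wh (linv v) Y) (ext (wh v Y) y) = y"
      using wh_inverse[OF assms, of "(y, True)"] wh_inverse[OF v', of "(y, True)"] by simp_all
  qed
qed

end

section \<open>Counting reduced words\<close>

lemma geometric_partial_le:
  fixes x :: real
  assumes "0 \<le> x" "x < 1"
  shows "(\<Sum>n<N. x ^ n) \<le> 1 / (1 - x)"
  using sum_le_suminf[of "\<lambda>n. x ^ n" "{..<N}"] assms suminf_geometric[of x] by simp

locale fin_free_on = free_on +
  assumes fin_X: "finite X" and card_X: "card X \<ge> 2"
begin

lemma fin_letters [simp]: "finite letters"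
  using fin_X by (simp add: letters_def)

lemma card_letters: "card letters = 2 * card X"
  by (simp add: letters_def card_cartesian_product)

lemma finite_continuations: "finite {w. a # w \<in> RW \<and> length w = n}"
  by (rule finite_subset[OF _ finite_RW_le[OF fin_X, of n]]) (auto simp: RW_Cons_iff)

definition cross_sum :: "real \<Rightarrow> ('a \<times> bool) set \<Rightarrow> nat \<Rightarrow> 'a \<times> bool \<Rightarrow> real" where
  "cross_sum s Y n a = (\<Sum>w | a # w \<in> RW \<and> length w = n. s ^ cross Y (a # w))"

lemma cross_sum_0: "a \<in> letters \<Longrightarrow> cross_sum s Y 0 a = 1"
proof -
  assume "a \<in> letters"
  then have "{w. a # w \<in> RW \<and> length w = 0} = {[]}"
    by (auto simp: RW_Cons_iff)
  then show ?thesis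
    by (simp add: cross_sum_def)
qed

lemma cross_sum_Suc:
  assumes "a \<in> letters"
  shows "cross_sum s Y (Suc n) a =
    (\<Sum>b\<in>letters - {linv a}. (if (linv a \<in> Y) = (b \<in> Y) then 1 else s) * cross_sum s Y n b)"
proof -
  let ?S = "\<lambda>b. (#) b ` {w. b # w \<in> RW \<and> length w = n}"
  have eq: "{w. a # w \<in> RW \<and> length w = Suc n} = (\<Union>b\<in>letters - {linv a}. ?S b)"
  proof (intro subset_antisym subsetI)
    fix w assume w: "w \<in> {w. a # w \<in> RW \<and> length w = Suc n}"
    then obtain b u where u: "w = b # u"
      by (auto simp: length_Suc_conv)
    then have "b \<in> letters - {linv a}" "w \<in> ?S b"
      using w by (auto simp: RW_Cons_iff)
    then show "w \<in> (\<Union>b\<in>letters - {linv a}. ?S b)"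
      by blast
  qed (use assms in \<open>auto simp: RW_Cons_iff\<close>)
  have "cross_sum s Y (Suc n) a = (\<Sum>b\<in>letters - {linv a}. \<Sum>w\<in>?S b. s ^ cross Y (a # w))"
    unfolding cross_sum_def eq by (rule sum.UNION_disjoint) (auto simp: finite_continuations)
  also have "\<dots> = (\<Sum>b\<in>letters - {linv a}. (if (linv a \<in> Y) = (b \<in> Y) then 1 else s) * cross_sum s Y n b)"
    unfolding cross_sum_def
    by (intro sum.cong refl, subst sum.reindex) (auto simp: sum_distrib_left)
  finally show ?thesis .
qed

text \<open>\<open>f\<close> is a positive super-eigenvector, for the rate \<open>\<rho>\<close>, of
  the transfer matrix that \<open>cross_sum\<close> iterates; the induction starts from
  \<open>1 \<le> f a / \<eta>\<close>.\<close>

lemma cross_sum_le: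
  assumes s: "s \<ge> 0" and \<eta>: "\<eta> > 0" and f: "\<And>a. a \<in> letters \<Longrightarrow> f a \<ge> \<eta>" and \<rho>: "\<rho> \<ge> 0"
    and step: "\<And>a. a \<in> letters \<Longrightarrow>
      (\<Sum>b\<in>letters - {linv a}. (if (linv a \<in> Y) = (b \<in> Y) then 1 else s) * f b) \<le> \<rho> * f a"
    and a: "a \<in> letters"
  shows "cross_sum s Y n a \<le> \<rho> ^ n * (f a / \<eta>)"
  using a
proof (induction n arbitrary: a)
  case 0
  then show ?case
    using f[of a] \<eta> by (simp add: cross_sum_0)
next
  case (Suc n)
  let ?c = "\<lambda>b. if (linv a \<in> Y) = (b \<in> Y) then 1 else s"
  have "cross_sum s Y (Suc n) a = (\<Sum>b\<in>letters - {linv a}. ?c b * cross_sum s Y n b)"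
    by (rule cross_sum_Suc) fact
  also have "\<dots> \<le> (\<Sum>b\<in>letters - {linv a}. ?c b * (\<rho> ^ n * (f b / \<eta>)))"
    using Suc s by (intro sum_mono mult_left_mono) auto
  also have "\<dots> = \<rho> ^ n / \<eta> * (\<Sum>b\<in>letters - {linv a}. ?c b * f b)"
    by (simp add: sum_distrib_left mult_ac)
  also have "\<dots> \<le> \<rho> ^ n / \<eta> * (\<rho> * f a)"
    using step[OF Suc.prems] \<eta> \<rho> by (intro mult_left_mono) auto
  finally show ?case
    by (simp add: mult_ac)
qed

text \<open>With the first letter split off, the words of length \<open>n + 1\<close> contribute a
  multiple of \<open>(\<sigma> * \<rho>) ^ n\<close> at most, so a geometric series bounds the
  sum.\<close>

lemma words_sum_le:
  fixes s \<rho> \<sigma> \<eta> :: real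
  assumes s: "s \<ge> 0" and \<eta>: "\<eta> > 0" and f: "\<And>a. a \<in> letters \<Longrightarrow> f a \<ge> \<eta>" and \<rho>: "\<rho> \<ge> 0"
    and step: "\<And>a. a \<in> letters \<Longrightarrow>
      (\<Sum>b\<in>letters - {linv a}. (if (linv a \<in> Y) = (b \<in> Y) then 1 else s) * f b) \<le> \<rho> * f a"
    and \<sigma>: "0 < \<sigma>" "\<sigma> * \<rho> < 1"
  shows "\<exists>K. \<forall>N. (\<Sum>w | w \<in> RW \<and> length w \<le> N. s ^ cross Y w * \<sigma> ^ length w) \<le> K"
proof (intro exI allI)
  fix N
  let ?F = "\<lambda>w. s ^ cross Y w * \<sigma> ^ length w"
  let ?S = "\<lambda>n a. (#) a ` {w. a # w \<in> RW \<and> length w = n}"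
  have split: "{w. w \<in> RW \<and> length w \<le> N} = insert [] (\<Union>(n, a)\<in>{..<N} \<times> letters. ?S n a)"
  proof (intro subset_antisym subsetI)
    fix w assume w: "w \<in> {w. w \<in> RW \<and> length w \<le> N}"
    show "w \<in> insert [] (\<Union>(n, a)\<in>{..<N} \<times> letters. ?S n a)"
    proof (cases w)
      case (Cons a u)
      then have "(length u, a) \<in> {..<N} \<times> letters" "w \<in> ?S (length u) a"
        using w by (auto simp: RW_Cons_iff)
      then show ?thesis by blast
    qed simp
  qed auto
  have "(\<Sum>w | w \<in> RW \<and> length w \<le> N. ?F w) = 1 + (\<Sum>w\<in>(\<Union>(n, a)\<in>{..<N} \<times> letters. ?S n a). ?F w)"
    unfolding split by (subst sum.insert) (auto simp: finite_continuations)
  also have "(\<Sum>w\<in>(\<Union>(n, a)\<in>{..<N} \<times> letters. ?S n a). ?F w) =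
      (\<Sum>p\<in>{..<N} \<times> letters. \<Sum>w\<in>(case p of (n, a) \<Rightarrow> ?S n a). ?F w)"
    by (rule sum.UNION_disjoint) (auto simp: finite_continuations)
  also have "\<dots> = (\<Sum>n<N. \<Sum>a\<in>letters. \<Sum>w\<in>?S n a. ?F w)"
    unfolding sum.cartesian_product by (intro sum.cong refl) (simp split: prod.split)
  also have "\<dots> = (\<Sum>n<N. \<Sum>a\<in>letters. \<sigma> ^ Suc n * cross_sum s Y n a)"
  proof (intro sum.cong refl)
    fix n a
    show "(\<Sum>w\<in>?S n a. ?F w) = \<sigma> ^ Suc n * cross_sum s Y n a"
      unfolding cross_sum_def
      by (subst sum.reindex) (auto simp: sum_distrib_left mult_ac intro!: sum.cong)
  qed
  also have "\<dots> \<le> (\<Sum>n<N. \<Sum>a\<in>letters. \<sigma> ^ Suc n * (\<rho> ^ n * (f a / \<eta>)))"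
    using cross_sum_le[OF s \<eta> f \<rho> step] \<sigma> by (intro sum_mono mult_left_mono) auto
  also have "\<dots> = (\<Sum>n<N. (\<sigma> * \<rho>) ^ n) * (\<sigma> * (\<Sum>a\<in>letters. f a / \<eta>))"
    by (simp add: sum_distrib_left sum_distrib_right power_mult_distrib mult_ac)
  also have "\<dots> \<le> 1 / (1 - \<sigma> * \<rho>) * (\<sigma> * (\<Sum>a\<in>letters. f a / \<eta>))"
  proof (intro mult_right_mono geometric_partial_le mult_nonneg_nonneg sum_nonneg divide_nonneg_pos)
    show "0 \<le> f a" if "a \<in> letters" for a
      using f[OF that] \<eta> by simp
  qed (use \<sigma> \<rho> \<eta> in auto)
  finally show "(\<Sum>w | w \<in> RW \<and> length w \<le> N. ?F w) \<le>
      1 + 1 / (1 - \<sigma> * \<rho>) * (\<sigma> * (\<Sum>a\<in>letters. f a / \<eta>))"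
    by simp
qed

lemma all_words_sum_le:
  assumes "0 < \<sigma>" "\<sigma> * (2 * real (card X) - 1) < 1"
  shows "\<exists>K. \<forall>N. (\<Sum>w | w \<in> RW \<and> length w \<le> N. \<sigma> ^ length w) \<le> K"
proof -
  have "\<exists>K. \<forall>N. (\<Sum>w | w \<in> RW \<and> length w \<le> N. 1 ^ cross {} w * \<sigma> ^ length w) \<le> K"
  proof (rule words_sum_le[where f = "\<lambda>_. 1" and \<eta> = 1 and \<rho> = "2 * real (card X) - 1"])
    fix a assume "a \<in> letters"
    then have "card (letters - {linv a}) = 2 * card X - 1"
      by (simp add: card_Diff_singleton card_letters)
    then show "(\<Sum>b\<in>letters - {linv a}. (if (linv a \<in> {}) = (b \<in> {}) then 1 else 1) * 1) \<le>
        (2 * real (card X) - 1) * 1"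
      using card_X by (simp add: of_nat_diff)
  qed (use assms card_X in auto)
  then show ?thesis by simp
qed

text \<open>
  Walking along a word moves between the two sides of the cut at the cost of a factor \<open>s\<close>, and a
  side with \<open>m\<close> letters leaves at most \<open>m - 1\<close> continuations. The larger side has at most
  \<open>2 * card X - 1\<close> letters; when \<open>Y = {y}\<close> it does have that many, but then \<open>linv y\<close> is a
  dead end inside it, which the small weight \<open>f (linv y)\<close> takes into account.
\<close>

lemma cut_words_sum_le:
  assumes v: "v \<in> letters" and Y: "Y \<subseteq> letters - {v, linv v}" "Y \<noteq> {}"
    and \<sigma>: "0 < \<sigma>" "\<sigma> * (2 * real (card X) - 3) < 1"
  shows "\<exists>s K. 0 < s \<and> s \<le> 1 \<and>
    (\<forall>N. (\<Sum>w | w \<in> RW \<and> length w \<le> N. s ^ cross Y w * \<sigma> ^ length w) \<le> K)"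
proof -
  define d where "d = real (card letters)"
  have d_X: "d = 2 * real (card X)"
    by (simp add: d_def card_letters)
  have d: "d \<ge> 4"
    using card_X by (simp add: d_X)
  have "d - 3 < 1 / \<sigma>"
    using \<sigma> d_X by (simp add: field_simps)
  \<comment> \<open>The rate to be proved lies strictly between the critical rate
    \<open>d - 3\<close> and \<open>1 / \<sigma>\<close>; the minimum with \<open>d - 2\<close>
    taken next keeps \<open>\<delta>\<close> at most 1.\<close>
  then obtain \<rho>' where \<rho>': "d - 3 < \<rho>'" "\<rho>' < 1 / \<sigma>"
    using dense by blast
  define \<rho> where "\<rho> = min \<rho>' (d - 2)"
  define \<delta> where "\<delta> = \<rho> - (d - 3)"
  have \<delta>: "0 < \<delta>" "\<delta> \<le> 1" and \<rho>: "\<rho> = d - 3 + \<delta>"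
    using \<rho>'(1) by (auto simp: \<delta>_def \<rho>_def)
  have "\<rho> < 1 / \<sigma>"
    using \<rho>'(2) by (simp add: \<rho>_def)
  then have \<sigma>\<rho>: "\<sigma> * \<rho> < 1"
    using \<sigma> by (simp add: field_simps)
  \<comment> \<open>Small enough that all crossings together cost only a fraction of
    \<open>\<delta>\<close>.\<close>
  define s where "s = \<delta> / (4 * d)"
  have s: "0 < s" "s \<le> 1" "s * d = \<delta> / 4" "4 * s \<le> \<delta> / 4"
  proof -
    show "0 < s" "s * d = \<delta> / 4"
      using \<delta> d by (simp_all add: s_def)
    have "s * 4 \<le> s * d"
      using \<open>0 < s\<close> d by (intro mult_left_mono) auto
    then show "4 * s \<le> \<delta> / 4"
      using \<open>s * d = \<delta> / 4\<close> by simp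
    then show "s \<le> 1"
      using \<delta> by simp
  qed
  have "\<exists>K. \<forall>N. (\<Sum>w | w \<in> RW \<and> length w \<le> N. s ^ cross Y w * \<sigma> ^ length w) \<le> K"
  proof (cases "\<exists>y. Y = {y}")
    case False
    have step: "(\<Sum>b\<in>letters - {linv a}. (if (linv a \<in> Y) = (b \<in> Y) then 1 else s) * 1) \<le> \<rho> * 1"
      if a: "a \<in> letters" for a
    proof -
      let ?S = "if linv a \<in> Y then Y else letters - Y"
      have fin: "finite Y" "Y \<subseteq> letters"
        using Y(1) finite_subset[OF _ fin_letters] by auto
      have S: "?S \<subseteq> letters" "linv a \<in> ?S"
        using Y a by auto
      \<comment> \<open>Two letters lie across the cut: \<open>v\<close> and \<open>linv v\<close>
        if the current side is \<open>Y\<close>, and two elements of \<open>Y\<close>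
        otherwise.\<close>
      have "\<exists>T. T \<subseteq> letters - ?S \<and> card T = 2"
      proof (cases "linv a \<in> Y")
        case True
        then show ?thesis
          using Y v by (intro exI[of _ "{v, linv v}"]) auto
      next
        case notin: False
        obtain y where y: "y \<in> Y"
          using Y(2) by blast
        then obtain z where "z \<in> Y" "z \<noteq> y"
          using False by blast
        with y show ?thesis
          using notin fin by (intro exI[of _ "{y, z}"]) auto
      qed
      then obtain T where T: "T \<subseteq> letters - ?S" "card T = 2" by blast
      have "card (?S \<union> T) = card ?S + card T"
        using S T by (intro card_Un_disjoint) (auto intro: finite_subset[OF _ fin_letters])
      moreover have "card (?S \<union> T) \<le> card letters"
        using S T by (intro card_mono) auto
      ultimately have cS: "card ?S + 2 \<le> card letters"
        using T by simp
      have "(\<Sum>b\<in>letters - {linv a}. (if (linv a \<in> Y) = (b \<in> Y) then 1 else s) * 1) \<le>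
          (\<Sum>b\<in>letters - {linv a}. (if b \<in> ?S then 1 else 0) + s)"
        using s by (intro sum_mono) auto
      also have "\<dots> = real (card ((letters - {linv a}) \<inter> ?S)) + s * real (card (letters - {linv a}))"
        by (simp add: sum.distrib flip: sum.inter_restrict)
      also have "(letters - {linv a}) \<inter> ?S = ?S - {linv a}"
        using S by auto
      also have "real (card (?S - {linv a})) = real (card ?S) - 1"
        using S finite_subset[OF S(1) fin_letters] card_gt_0_iff[of ?S]
        by (subst card_Diff_singleton) (auto simp: of_nat_diff)
      also have "real (card ?S) - 1 + s * real (card (letters - {linv a})) \<le> (d - 3) + s * d"
        using cS s(1) by (intro add_mono mult_left_mono) (auto simp: d_def intro: card_mono)
      also have "\<dots> \<le> \<rho> * 1"
        using s \<delta> \<rho> by simp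
      finally show ?thesis .
    qed
    show ?thesis
      by (rule words_sum_le[OF _ _ _ _ step \<sigma>(1) \<sigma>\<rho>, where \<eta> = 1]) (use s \<rho> d \<delta> in auto)
  next
    case True
    then obtain y where y: "Y = {y}" by blast
    have yl: "y \<in> letters"
      using Y y by auto
    \<comment> \<open>After \<open>y\<close> there are \<open>d - 2\<close> continuations without a
      crossing; the value 2 pays for them, as \<open>d - 2 \<le> 2 * (d - 3)\<close>. After
      \<open>linv y\<close> every continuation crosses, so a value as small as
      \<open>\<delta> / 2\<close> suffices there.\<close>
    define f where "f b = (if b = y then 2 else if b = linv y then \<delta> / 2 else 1)" for b
    have f: "f y = 2" "f (linv y) = \<delta> / 2" "\<And>b. b \<noteq> y \<Longrightarrow> b \<noteq> linv y \<Longrightarrow> f b = 1"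
      by (auto simp: f_def)
    have step: "(\<Sum>b\<in>letters - {linv a}. (if (linv a \<in> Y) = (b \<in> Y) then 1 else s) * f b) \<le> \<rho> * f a"
      if a: "a \<in> letters" for a
    proof -
      let ?c = "\<lambda>b. if (linv a \<in> Y) = (b \<in> Y) then 1 else s"
      consider (dead) "a = linv y" | (self) "a = y" | (other) "a \<noteq> y" "a \<noteq> linv y"
        by blast
      then show ?thesis
      proof cases
        case dead
        have "(\<Sum>b\<in>letters - {linv a}. ?c b * f b) \<le> (\<Sum>b\<in>letters - {linv a}. s)"
          using dead y s \<delta> by (intro sum_mono) (auto simp: f_def)
        also have "\<dots> = s * real (card (letters - {linv a}))"
          by simp
        also have "\<dots> \<le> s * d"
          using s by (intro mult_left_mono) (auto simp: d_def intro: card_mono)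
        also have "\<dots> \<le> 1 * (\<delta> / 2)"
          using s \<delta> by simp
        also have "\<dots> \<le> \<rho> * (\<delta> / 2)"
          using \<rho> d \<delta> by (intro mult_right_mono) auto
        finally have "(\<Sum>b\<in>letters - {linv a}. ?c b * f b) \<le> \<rho> * (\<delta> / 2)" .
        moreover have "f a = \<delta> / 2"
          using dead f(2) by simp
        ultimately show ?thesis by metis
      next
        case self
        have split: "letters - {linv a} = insert y (letters - {y, linv y})"
          using self yl by auto
        have "(\<Sum>b\<in>letters - {linv a}. ?c b * f b) = s * 2 + (\<Sum>b\<in>letters - {y, linv y}. ?c b * f b)"
          unfolding split using self y f by (subst sum.insert) auto
        also have "(\<Sum>b\<in>letters - {y, linv y}. ?c b * f b) = (\<Sum>b\<in>letters - {y, linv y}. 1)"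
          using self y f by (intro sum.cong) auto
        also have "\<dots> = d - 2"
          using yl d by (simp add: card_Diff_subset d_def of_nat_diff)
        also have "s * 2 + (d - 2) \<le> \<rho> * 2"
          using s \<rho> d \<delta> by simp
        finally show ?thesis
          using self f by simp
      next
        case other
        have c: "card {y, linv y, linv a} = 3" "{y, linv y, linv a} \<subseteq> letters"
          using other yl a linv_linv[of a] by (auto simp: card_insert_if)
        have split: "letters - {linv a} = insert y (insert (linv y) (letters - {y, linv y, linv a}))"
          using other yl by auto
        have "(\<Sum>b\<in>letters - {linv a}. ?c b * f b) =
            s * 2 + (\<delta> / 2 + (\<Sum>b\<in>letters - {y, linv y, linv a}. ?c b * f b))"
          unfolding split using other y f linv_linv[of a] by (subst sum.insert, simp, simp)+ auto
        also have "(\<Sum>b\<in>letters - {y, linv y, linv a}. ?c b * f b) =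
            (\<Sum>b\<in>letters - {y, linv y, linv a}. 1)"
          using other y f linv_linv[of a] by (intro sum.cong) auto
        also have "\<dots> = d - 3"
          using c d card_Diff_subset[OF _ c(2)] by (simp add: d_def of_nat_diff)
        also have "s * 2 + (\<delta> / 2 + (d - 3)) \<le> \<rho>"
          using s \<rho> \<delta> by simp
        finally show ?thesis
          using other f by simp
      qed
    qed
    show ?thesis
      by (rule words_sum_le[OF _ _ _ _ step \<sigma>(1) \<sigma>\<rho>, where \<eta> = "\<delta> / 2"]) (use s \<rho> d \<delta> in \<open>auto simp: f_def\<close>)
  qed
  with s show ?thesis by blast
qed

text \<open>Fewer than \<open>J\<close> crossings cost a factor of at least \<open>s ^ J\<close>, by
  which the weighted bound can be divided.\<close>

lemma few_crossings_sum_le: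
  assumes v: "v \<in> letters" and Y: "Y \<subseteq> letters - {v, linv v}" "Y \<noteq> {}"
    and \<sigma>: "0 < \<sigma>" "\<sigma> * (2 * real (card X) - 3) < 1"
  shows "\<exists>K. \<forall>N. (\<Sum>w | w \<in> RW \<and> length w \<le> N \<and> cross Y w < J. \<sigma> ^ length w) \<le> K"
proof -
  obtain s K where s: "0 < s" "s \<le> 1"
    and K: "\<And>N. (\<Sum>w | w \<in> RW \<and> length w \<le> N. s ^ cross Y w * \<sigma> ^ length w) \<le> K"
    using cut_words_sum_le[OF assms] by blast
  have "(\<Sum>w | w \<in> RW \<and> length w \<le> N \<and> cross Y w < J. \<sigma> ^ length w) \<le> K / s ^ J" for N
  proof -
    have "s ^ J * (\<Sum>w | w \<in> RW \<and> length w \<le> N \<and> cross Y w < J. \<sigma> ^ length w) \<le>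
        (\<Sum>w | w \<in> RW \<and> length w \<le> N \<and> cross Y w < J. s ^ cross Y w * \<sigma> ^ length w)"
      unfolding sum_distrib_left
      using s \<sigma> by (intro sum_mono mult_right_mono power_decreasing) auto
    also have "\<dots> \<le> (\<Sum>w | w \<in> RW \<and> length w \<le> N. s ^ cross Y w * \<sigma> ^ length w)"
      using s \<sigma> finite_RW_le[OF fin_X] by (intro sum_mono2) auto
    also have "\<dots> \<le> K"
      by (rule K)
    finally show ?thesis
      using s by (simp add: field_simps)
  qed
  then show ?thesis by blast
qed

end

section \<open>The growth of the set of primitive words\<close>

text \<open>If \<open>w @ w\<close> is not reduced, then the first and last letters of
  \<open>w\<close> are mutually inverse and can be stripped off.\<close>

lemma cyclic_reduction:
  assumes "reduced w"
  shows "\<exists>u c. w = u @ c @ winv u \<and> reduced (c @ c)"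
  using assms
proof (induction "length w" arbitrary: w rule: less_induct)
  case less
  show ?case
  proof (cases "reduced (w @ w)")
    case True
    then show ?thesis
      by (intro exI[of _ "[]"] exI[of _ w]) simp
  next
    case False
    then have w: "w \<noteq> []" "hd w = linv (last w)"
      using less.prems by (auto simp: reduced_append)
    then obtain a w' where a: "w = a # w'"
      by (cases w) auto
    have "w' \<noteq> []"
      using w a by auto
    then obtain w'' b where b: "w' = w'' @ [b]"
      by (metis append_butlast_last_id)
    have "b = linv a"
      using w a b by simp
    have "reduced w''"
      using less.prems a b by (auto simp: reduced_Cons reduced_append)
    then obtain u c where "w'' = u @ c @ winv u" "reduced (c @ c)"
      using less.hyps[of w''] a b by auto
    then show ?thesis
      using a b \<open>b = linv a\<close> by (intro exI[of _ "a # u"] exI[of _ c]) simp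
  qed
qed

context fin_free_on begin

definition prim_ball :: "nat \<Rightarrow> 'a set" where
  "prim_ball N = {g \<in> primitive_words G. len g \<le> N}"

definition cyc_prim_ball :: "nat \<Rightarrow> 'a set" where
  "cyc_prim_ball N = {g \<in> prim_ball N. reduced (rw g @ rw g)}"

lemma prim_ball_carrier: "g \<in> prim_ball N \<Longrightarrow> g \<in> carrier G"
  using primitive_carrier by (simp add: prim_ball_def)

lemma finite_prim_ball [simp]: "finite (prim_ball N)" "finite (cyc_prim_ball N)"
  by (rule finite_subset[OF _ finite_ball[OF fin_X, of N]],
      use primitive_carrier in \<open>auto simp: prim_ball_def cyc_prim_ball_def\<close>)+

text \<open>Conjugation is an automorphism, so the cyclically reduced core of a primitive word is
  primitive. The conjugator counts twice in the length because no cancellation occurs.\<close>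

lemma prim_conj_decomp:
  assumes g: "g \<in> prim_ball N"
  shows "\<exists>u h. u \<in> RW \<and> length u \<le> N \<and> h \<in> cyc_prim_ball N \<and>
    g = wv u \<otimes> h \<otimes> inv (wv u) \<and> len g = 2 * length u + len h"
proof -
  have gc: "g \<in> carrier G" and gp: "g \<in> primitive_words G" and gN: "len g \<le> N"
    using g prim_ball_carrier by (auto simp: prim_ball_def)
  obtain u c where uc: "rw g = u @ c @ winv u" "reduced (c @ c)"
    using cyclic_reduction RW_reduced[OF rw_RW[OF gc]] by blast
  have RW: "u \<in> RW" "c \<in> RW"
    using rw_RW[OF gc] uc(1) by (auto simp: RW_append_iff)
  have cl: "wv u \<in> carrier G" "wv c \<in> carrier G"
    by (rule wv_closed[OF RW_letters[OF RW(1)]], rule wv_closed[OF RW_letters[OF RW(2)]])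
  have geq: "g = wv u \<otimes> wv c \<otimes> inv (wv u)"
  proof -
    have "g = wv (u @ c @ winv u)"
      using wv_rw[OF gc] uc(1) by simp
    also have "\<dots> = wv u \<otimes> (wv c \<otimes> inv (wv u))"
      using RW_letters[OF RW(1)] RW_letters[OF RW(2)] by (simp add: wv_append wv_winv)
    finally show ?thesis
      using cl by (simp add: m_assoc)
  qed
  have "inv (wv u) \<otimes> g \<otimes> wv u = (inv (wv u) \<otimes> wv u) \<otimes> wv c \<otimes> (inv (wv u) \<otimes> wv u)"
    unfolding geq using cl by (simp only: m_assoc m_closed inv_closed)
  then have "inv (wv u) \<otimes> g \<otimes> wv u = wv c"
    using cl by simp
  then have "wv c \<in> primitive_words G"
    using primitive_iso[OF conj_iso[OF cl(1)] gp] by simp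
  moreover have len_g: "len g = 2 * length u + len (wv c)"
    using RW by (simp add: len_def uc(1))
  ultimately have "wv c \<in> cyc_prim_ball N"
    using gN RW uc(2) by (simp add: cyc_prim_ball_def prim_ball_def)
  then show ?thesis
    using RW geq len_g gN by (intro exI[of _ u] exI[of _ "wv c"]) auto
qed

section \<open>Boundedness of the weighted sum over the primitive elements\<close>

context
  fixes \<sigma> :: real
  assumes \<sigma>_pos: "0 < \<sigma>" and \<sigma>1: "\<sigma> * (2 * real (card X) - 3) < 1"
    and \<sigma>2: "\<sigma>\<^sup>2 * (2 * real (card X) - 1) < 1"
begin

lemma \<sigma>_less_1: "\<sigma> < 1"
proof (rule ccontr)
  assume "\<not> \<sigma> < 1"
  then have "1 * 1 \<le> \<sigma>\<^sup>2 * (2 * real (card X) - 1)"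
    using card_X by (intro mult_mono) auto
  with \<sigma>2 show False by simp
qed

text \<open>Every letter of the conjugator costs the square of \<open>\<sigma>\<close>, so the sum
  over all conjugators is bounded by the assumption \<open>\<sigma>2\<close>.\<close>

lemma prim_sum_le_cyc:
  "\<exists>K \<ge> 0. \<forall>N. (\<Sum>g\<in>prim_ball N. \<sigma> ^ len g) \<le> K * (\<Sum>g\<in>cyc_prim_ball N. \<sigma> ^ len g)"
proof -
  obtain K where K: "\<And>N. (\<Sum>w | w \<in> RW \<and> length w \<le> N. (\<sigma>\<^sup>2) ^ length w) \<le> K"
    using all_words_sum_le[of "\<sigma>\<^sup>2"] \<sigma>2 \<sigma>_pos by auto
  have K0: "K \<ge> 0"
    using K[of 0] \<sigma>_pos by (intro order_trans[OF sum_nonneg K[of 0]]) auto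
  have "(\<Sum>g\<in>prim_ball N. \<sigma> ^ len g) \<le> K * (\<Sum>g\<in>cyc_prim_ball N. \<sigma> ^ len g)" for N
  proof -
    let ?U = "{w. w \<in> RW \<and> length w \<le> N}"
    have "(\<Sum>g\<in>prim_ball N. \<sigma> ^ len g) \<le>
        (\<Sum>p\<in>?U \<times> cyc_prim_ball N. (\<sigma>\<^sup>2) ^ length (fst p) * \<sigma> ^ len (snd p))"
    proof (rule sum_le_included[where i = "\<lambda>p. wv (fst p) \<otimes> snd p \<otimes> inv (wv (fst p))"])
      show "finite (?U \<times> cyc_prim_ball N)"
        using finite_RW_le[OF fin_X, of N] by simp
      show "\<forall>g\<in>prim_ball N. \<exists>p\<in>?U \<times> cyc_prim_ball N.
          wv (fst p) \<otimes> snd p \<otimes> inv (wv (fst p)) = g \<and>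
          \<sigma> ^ len g \<le> (\<sigma>\<^sup>2) ^ length (fst p) * \<sigma> ^ len (snd p)"
      proof
        fix g assume "g \<in> prim_ball N"
        from prim_conj_decomp[OF this] obtain u h where uh: "u \<in> RW" "length u \<le> N"
          "h \<in> cyc_prim_ball N" "g = wv u \<otimes> h \<otimes> inv (wv u)" "len g = 2 * length u + len h"
          by blast
        have "\<sigma> ^ len g \<le> (\<sigma>\<^sup>2) ^ length u * \<sigma> ^ len h"
          unfolding uh(5) by (simp add: power_add power_mult)
        then show "\<exists>p\<in>?U \<times> cyc_prim_ball N.
            wv (fst p) \<otimes> snd p \<otimes> inv (wv (fst p)) = g \<and>
            \<sigma> ^ len g \<le> (\<sigma>\<^sup>2) ^ length (fst p) * \<sigma> ^ len (snd p)"
          using uh by (intro bexI[of _ "(u, h)"]) auto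
      qed
    qed (use \<sigma>_pos in auto)
    also have "\<dots> = (\<Sum>w\<in>?U. (\<sigma>\<^sup>2) ^ length w) * (\<Sum>g\<in>cyc_prim_ball N. \<sigma> ^ len g)"
      by (simp add: sum_product sum.cartesian_product case_prod_beta)
    also have "\<dots> \<le> K * (\<Sum>g\<in>cyc_prim_ball N. \<sigma> ^ len g)"
      using K[of N] \<sigma>_pos by (intro mult_right_mono sum_nonneg) auto
    finally show ?thesis .
  qed
  with K0 show ?thesis by blast
qed

definition cuts :: "(('a \<times> bool) \<times> ('a \<times> bool) set) set" where
  "cuts = {(v, Y). v \<in> letters \<and> Y \<subseteq> letters - {v, linv v} \<and> Y \<noteq> {}}"

lemma finite_cuts: "finite cuts"
  by (rule finite_subset[of _ "letters \<times> Pow letters"]) (auto simp: cuts_def)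

text \<open>The Whitehead automorphism maps \<open>Q\<close> injectively to primitive elements that
  are shorter by at least \<open>J - 2\<close>.\<close>

lemma whitehead_sum_le:
  assumes vY: "(v, Y) \<in> cuts" and J: "J \<ge> 2"
    and Q: "Q = {g \<in> cyc_prim_ball N. successively (link v Y) (rw g) \<and> J \<le> cross Y (rw g)}"
  shows "(\<Sum>g\<in>Q. \<sigma> ^ len g) \<le> \<sigma> ^ (J - 2) * (\<Sum>g\<in>prim_ball N. \<sigma> ^ len g)"
proof -
  have v: "v \<in> letters" and Y: "Y \<subseteq> letters - {v, linv v}"
    using vY by (auto simp: cuts_def)
  let ?\<phi> = "ext (wh v Y)"
  have iso: "?\<phi> \<in> iso G G"
    using v Y by (rule wh_iso)
  have Q_sub: "Q \<subseteq> prim_ball N"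
    by (auto simp: Q cyc_prim_ball_def)
  have Qc: "g \<in> carrier G" if "g \<in> Q" for g
    using that Q_sub prim_ball_carrier by blast
  have len: "len (?\<phi> g) + (J - 2) \<le> len g" if "g \<in> Q" for g
  proof -
    have "len (?\<phi> g) + cross Y (rw g) \<le> len g + 2"
      using that Q by (intro wh_length[OF v Y Qc[OF that]]) auto
    then show ?thesis
      using that Q J by auto
  qed
  have inj: "inj_on ?\<phi> Q"
    using iso Qc by (auto simp: iso_def bij_betw_def intro: inj_on_subset)
  have "(\<Sum>g\<in>Q. \<sigma> ^ len g) \<le> (\<Sum>g\<in>Q. \<sigma> ^ (J - 2) * \<sigma> ^ len (?\<phi> g))"
  proof (rule sum_mono)
    fix g assume "g \<in> Q"
    then have "\<sigma> ^ len g \<le> \<sigma> ^ (len (?\<phi> g) + (J - 2))"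
      using \<sigma>_pos \<sigma>_less_1 len by (intro power_decreasing) auto
    then show "\<sigma> ^ len g \<le> \<sigma> ^ (J - 2) * \<sigma> ^ len (?\<phi> g)"
      by (simp add: power_add mult_ac)
  qed
  also have "\<dots> = \<sigma> ^ (J - 2) * (\<Sum>g\<in>?\<phi> ` Q. \<sigma> ^ len g)"
    by (simp add: sum.reindex[OF inj] sum_distrib_left)
  also have "\<dots> \<le> \<sigma> ^ (J - 2) * (\<Sum>g\<in>prim_ball N. \<sigma> ^ len g)"
  proof (intro mult_left_mono sum_mono2)
    show "?\<phi> ` Q \<subseteq> prim_ball N"
    proof
      fix h assume "h \<in> ?\<phi> ` Q"
      then obtain g where g: "g \<in> Q" "h = ?\<phi> g" by blast
      then have "g \<in> primitive_words G" "len g \<le> N"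
        using Q_sub by (auto simp: prim_ball_def)
      then show "h \<in> prim_ball N"
        using primitive_iso[OF iso, of g] len[OF g(1)] g(2) by (simp add: prim_ball_def)
    qed
  qed (use \<sigma>_pos in auto)
  finally show ?thesis .
qed

text \<open>The cut vertex lemma assigns a cut to each element. For each of the finitely many cuts,
  words with fewer than \<open>J\<close> crossings have a bounded sum, and the others are shortened
  by the automorphism of the cut.\<close>

lemma cyc_prim_sum_le:
  assumes J: "J \<ge> 2"
  shows "\<exists>K. \<forall>N. (\<Sum>g\<in>cyc_prim_ball N. \<sigma> ^ len g) \<le>
    K + real (card cuts) * \<sigma> ^ (J - 2) * (\<Sum>g\<in>prim_ball N. \<sigma> ^ len g)"
proof -
  have "\<forall>p\<in>cuts. \<exists>K. \<forall>N.
      (\<Sum>w | w \<in> RW \<and> length w \<le> N \<and> cross (snd p) w < J. \<sigma> ^ length w) \<le> K"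
  proof
    fix p assume "p \<in> cuts"
    then have "fst p \<in> letters" "snd p \<subseteq> letters - {fst p, linv (fst p)}" "snd p \<noteq> {}"
      by (auto simp: cuts_def)
    then show "\<exists>K. \<forall>N.
        (\<Sum>w | w \<in> RW \<and> length w \<le> N \<and> cross (snd p) w < J. \<sigma> ^ length w) \<le> K"
      by (rule few_crossings_sum_le[OF _ _ _ \<sigma>_pos \<sigma>1])
  qed
  then obtain K where K: "\<And>p N. p \<in> cuts \<Longrightarrow>
      (\<Sum>w | w \<in> RW \<and> length w \<le> N \<and> cross (snd p) w < J. \<sigma> ^ length w) \<le> K p"
    unfolding bchoice_iff by blast
  have "(\<Sum>g\<in>cyc_prim_ball N. \<sigma> ^ len g) \<le>
      (\<Sum>p\<in>cuts. K p) + real (card cuts) * \<sigma> ^ (J - 2) * (\<Sum>g\<in>prim_ball N. \<sigma> ^ len g)" for N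
  proof -
    let ?Z = "\<Sum>g\<in>prim_ball N. \<sigma> ^ len g"
    define Q where "Q p = {g \<in> cyc_prim_ball N. successively (link (fst p) (snd p)) (rw g)}" for p
    have finQ: "finite (Q p)" for p
      by (simp add: Q_def)
    have "(\<Sum>g\<in>cyc_prim_ball N. \<sigma> ^ len g) \<le> (\<Sum>x\<in>Sigma cuts Q. \<sigma> ^ len (snd x))"
    proof (rule sum_le_included[where i = snd])
      show "finite (Sigma cuts Q)"
        using finite_cuts finQ by simp
      show "\<forall>g\<in>cyc_prim_ball N. \<exists>x\<in>Sigma cuts Q. snd x = g \<and> \<sigma> ^ len g \<le> \<sigma> ^ len (snd x)"
      proof
        fix g assume g: "g \<in> cyc_prim_ball N"
        then have "g \<in> primitive_words G" "reduced (rw g @ rw g)"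
          by (auto simp: cyc_prim_ball_def prim_ball_def)
        from cut_vertex[OF fin_X card_X this] obtain v Y
          where "v \<in> letters" "Y \<subseteq> letters - {v, linv v}" "Y \<noteq> {}" "successively (link v Y) (rw g)"
          by blast
        then show "\<exists>x\<in>Sigma cuts Q. snd x = g \<and> \<sigma> ^ len g \<le> \<sigma> ^ len (snd x)"
          using g by (intro bexI[of _ "((v, Y), g)"]) (auto simp: cuts_def Q_def)
      qed
    qed (use \<sigma>_pos in auto)
    also have "\<dots> = (\<Sum>p\<in>cuts. \<Sum>g\<in>Q p. \<sigma> ^ len g)"
      using sum.Sigma[of cuts Q "\<lambda>p g. \<sigma> ^ len g"] finite_cuts finQ by (simp add: case_prod_beta)
    also have "\<dots> \<le> (\<Sum>p\<in>cuts. K p + \<sigma> ^ (J - 2) * ?Z)"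
    proof (rule sum_mono)
      fix p assume p: "p \<in> cuts"
      let ?A = "{g \<in> Q p. cross (snd p) (rw g) < J}" and ?B = "{g \<in> Q p. J \<le> cross (snd p) (rw g)}"
      let ?W = "{w. w \<in> RW \<and> length w \<le> N \<and> cross (snd p) w < J}"
      have "(\<Sum>g\<in>Q p. \<sigma> ^ len g) = (\<Sum>g\<in>?A. \<sigma> ^ len g) + (\<Sum>g\<in>?B. \<sigma> ^ len g)"
        using finQ[of p] by (subst sum.union_disjoint[symmetric]) (auto intro!: sum.cong)
      also have "(\<Sum>g\<in>?A. \<sigma> ^ len g) \<le> (\<Sum>w\<in>?W. \<sigma> ^ length w)"
      proof (rule sum_le_included[where i = wv])
        show "finite ?W"
          by (rule finite_subset[OF _ finite_RW_le[OF fin_X, of N]]) auto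
        show "\<forall>g\<in>?A. \<exists>w\<in>?W. wv w = g \<and> \<sigma> ^ len g \<le> \<sigma> ^ length w"
        proof
          fix g assume g: "g \<in> ?A"
          then have "g \<in> prim_ball N"
            by (auto simp: Q_def cyc_prim_ball_def)
          then show "\<exists>w\<in>?W. wv w = g \<and> \<sigma> ^ len g \<le> \<sigma> ^ length w"
            using g prim_ball_carrier[of g N]
            by (intro bexI[of _ "rw g"]) (auto simp: prim_ball_def len_def)
        qed
      qed (use finQ \<sigma>_pos in auto)
      also have "\<dots> \<le> K p"
        by (rule K[OF p])
      also have "(\<Sum>g\<in>?B. \<sigma> ^ len g) \<le> \<sigma> ^ (J - 2) * ?Z"
        using p J by (intro whitehead_sum_le[of "fst p" "snd p"]) (auto simp: Q_def)
      finally show "(\<Sum>g\<in>Q p. \<sigma> ^ len g) \<le> K p + \<sigma> ^ (J - 2) * ?Z"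
        by simp
    qed
    also have "\<dots> = (\<Sum>p\<in>cuts. K p) + real (card cuts) * \<sigma> ^ (J - 2) * ?Z"
      by (simp add: sum.distrib)
    finally show ?thesis .
  qed
  then show ?thesis by blast
qed

text \<open>Bootstrap: for large \<open>n\<close> the two estimates give
  \<open>Z \<le> K1 * K2 + Z / 2\<close>, where \<open>Z\<close> is the finite sum for
  \<open>N\<close> and neither constant depends on \<open>N\<close>. Hence \<open>Z\<close> can be
  absorbed on the left.\<close>

theorem prim_sum_bounded: "\<exists>M. \<forall>N. (\<Sum>g\<in>prim_ball N. \<sigma> ^ len g) \<le> M"
proof -
  obtain K1 where K1: "K1 \<ge> 0"
    "\<And>N. (\<Sum>g\<in>prim_ball N. \<sigma> ^ len g) \<le> K1 * (\<Sum>g\<in>cyc_prim_ball N. \<sigma> ^ len g)"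
    using prim_sum_le_cyc by blast
  let ?c = "K1 * real (card cuts)"
  have "(\<lambda>n. ?c * \<sigma> ^ n) \<longlonglongrightarrow> ?c * 0"
    using \<sigma>_pos \<sigma>_less_1 by (intro tendsto_mult LIMSEQ_realpow_zero tendsto_const) auto
  then have "eventually (\<lambda>n. ?c * \<sigma> ^ n < 1 / 2) sequentially"
    by (rule order_tendstoD) simp
  then obtain n where n: "?c * \<sigma> ^ n < 1 / 2"
    by (auto simp: eventually_sequentially)
  obtain K2 where K2: "\<And>N. (\<Sum>g\<in>cyc_prim_ball N. \<sigma> ^ len g) \<le>
      K2 + real (card cuts) * \<sigma> ^ (n + 2 - 2) * (\<Sum>g\<in>prim_ball N. \<sigma> ^ len g)"
    using cyc_prim_sum_le[of "n + 2"] by auto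
  have "(\<Sum>g\<in>prim_ball N. \<sigma> ^ len g) \<le> 2 * (K1 * K2)" for N
  proof -
    let ?Z = "\<Sum>g\<in>prim_ball N. \<sigma> ^ len g"
    have Z: "?Z \<ge> 0"
      using \<sigma>_pos by (intro sum_nonneg) auto
    have "?Z \<le> K1 * (\<Sum>g\<in>cyc_prim_ball N. \<sigma> ^ len g)"
      by (rule K1)
    also have "\<dots> \<le> K1 * (K2 + real (card cuts) * \<sigma> ^ n * ?Z)"
      using K1(1) K2[of N] by (intro mult_left_mono) auto
    also have "\<dots> = K1 * K2 + ?c * \<sigma> ^ n * ?Z"
      by (simp add: algebra_simps)
    also have "?c * \<sigma> ^ n * ?Z \<le> 1 / 2 * ?Z"
      using n Z by (intro mult_right_mono) auto
    finally show ?thesis by simp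
  qed
  then show ?thesis by blast
qed

end

end

section \<open>Walks in the Cayley graph\<close>

text \<open>
  The number of walks of length \<open>t\<close> from the root to a given vertex at distance \<open>n\<close> in the
  \<open>(q + 1)\<close>-regular tree.
\<close>

primrec tree_walks :: "real \<Rightarrow> nat \<Rightarrow> nat \<Rightarrow> real" where
  "tree_walks q 0 n = (if n = 0 then 1 else 0)"
| "tree_walks q (Suc t) n =
    (if n = 0 then (q + 1) * tree_walks q t 1
     else tree_walks q t (n - 1) + q * tree_walks q t (n + 1))"

lemma tree_walks_nonneg: "q \<ge> 0 \<Longrightarrow> tree_walks q t n \<ge> 0"
  by (induction t arbitrary: n) auto

lemma tree_walks_eq_0: "n > t \<Longrightarrow> tree_walks q t n = 0"
  by (induction t arbitrary: n) auto

text \<open>\<open>s ^ n\<close> satisfies the radial recursion with eigenvalue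
  \<open>q * s + 1 / s\<close> away from the root, and as an inequality at the root because
  \<open>s \<le> 1\<close>.\<close>

lemma tree_walks_le:
  assumes "q \<ge> 0" "0 < s" "s \<le> 1"
  shows "tree_walks q t n \<le> (q * s + 1 / s) ^ t * s ^ n"
proof (induction t arbitrary: n)
  case 0
  then show ?case using assms by simp
next
  case (Suc t)
  let ?\<theta> = "q * s + 1 / s"
  have \<theta>: "?\<theta> \<ge> 0"
    using assms by simp
  show ?case
  proof (cases n)
    case 0
    have "1 * s \<le> 1 / s"
      using assms by (simp add: field_simps mult_le_one)
    then have "(q + 1) * s \<le> ?\<theta>"
      by (simp add: algebra_simps)
    have "tree_walks q (Suc t) n = (q + 1) * tree_walks q t 1"
      using 0 by simp
    also have "\<dots> \<le> (q + 1) * (?\<theta> ^ t * s ^ 1)"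
      using Suc[of 1] assms by (intro mult_left_mono) auto
    also have "\<dots> = ?\<theta> ^ t * ((q + 1) * s)"
      by simp
    also have "\<dots> \<le> ?\<theta> ^ t * ?\<theta>"
      using \<open>(q + 1) * s \<le> ?\<theta>\<close> \<theta> by (intro mult_left_mono) auto
    finally show ?thesis
      using 0 by (simp add: mult.commute)
  next
    case (Suc m)
    have "tree_walks q (Suc t) n = tree_walks q t m + q * tree_walks q t (m + 2)"
      using Suc by simp
    also have "\<dots> \<le> ?\<theta> ^ t * s ^ m + q * (?\<theta> ^ t * s ^ (m + 2))"
      by (intro add_mono mult_left_mono Suc.IH assms(1))
    also have "\<dots> = ?\<theta> ^ Suc t * s ^ n"
      using Suc assms(2) by (simp add: field_simps power2_eq_square)
    finally show ?thesis .
  qed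
qed

text \<open>Summation by parts moves the recursion from the walk counts to \<open>h\<close>, where
  each time step gains a factor \<open>\<theta>\<close>. The condition \<open>h 0 = 0\<close> takes
  care of the exceptional recursion at the root. The sum starts at time 1 because it vanishes at
  time 0.\<close>

lemma tree_walks_subsolution:
  fixes h :: "nat \<Rightarrow> real"
  assumes q: "q \<ge> 0" and \<theta>: "\<theta> \<ge> 0" and h: "\<And>n. h n \<ge> 0" "h 0 = 0"
    and sub: "\<And>n. \<theta> * h (Suc n) \<le> h (n + 2) + q * h n"
  shows "h 1 * \<theta> ^ t \<le> (\<Sum>n\<le>Suc t. h n * tree_walks q (Suc t) n)"
proof (induction t)
  case 0
  then show ?case
    using h by simp
next
  case (Suc t)
  let ?w = "tree_walks q (Suc t)"
  have "h 1 * \<theta> ^ Suc t \<le> \<theta> * (\<Sum>n\<le>Suc t. h n * ?w n)"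
    using mult_left_mono[OF Suc.IH \<theta>] by (simp add: mult_ac)
  also have "\<dots> = (\<Sum>n\<le>t. \<theta> * h (Suc n) * ?w (Suc n))"
    using h(2) by (subst sum.atMost_Suc_shift) (simp add: sum_distrib_left mult_ac del: tree_walks.simps)
  also have "\<dots> \<le> (\<Sum>n\<le>t. (h (n + 2) + q * h n) * ?w (Suc n))"
    by (intro sum_mono mult_right_mono sub tree_walks_nonneg[OF q])
  also have "\<dots> = (\<Sum>n\<le>t. h (n + 2) * ?w (Suc n)) + (\<Sum>n\<le>t. q * h n * ?w (Suc n))"
    by (simp add: sum.distrib algebra_simps del: tree_walks.simps)
  \<comment> \<open>The index shift adds the nonnegative term at distance 0.\<close>
  also have "(\<Sum>n\<le>t. h (n + 2) * ?w (Suc n)) \<le> (\<Sum>n\<le>Suc t. h (Suc n) * ?w n)"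
    using h tree_walks_nonneg[OF q]
    by (subst sum.atMost_Suc_shift) (simp del: tree_walks.simps)
  also have "(\<Sum>n\<le>t. q * h n * ?w (Suc n)) \<le> (\<Sum>n\<le>Suc t. h (Suc n) * (q * ?w (n + 2)))"
  proof -
    \<comment> \<open>The range is extended by nonnegative terms so that the shift, which drops the
      vanishing term with \<open>h 0\<close>, ends at \<open>Suc t\<close>.\<close>
    have "(\<Sum>n\<le>t. q * h n * ?w (Suc n)) \<le> (\<Sum>n\<le>Suc (Suc t). q * h n * ?w (Suc n))"
      using q h tree_walks_nonneg[OF q] by (intro sum_mono2) auto
    also have "\<dots> = (\<Sum>n\<le>Suc t. h (Suc n) * (q * ?w (n + 2)))"
      using h(2) by (subst sum.atMost_Suc_shift) (simp add: mult_ac del: tree_walks.simps)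
    finally show ?thesis .
  qed
  also have "(\<Sum>n\<le>Suc t. h (Suc n) * ?w n) + (\<Sum>n\<le>Suc t. h (Suc n) * (q * ?w (n + 2))) =
      (\<Sum>n\<le>Suc t. h (Suc n) * tree_walks q (Suc (Suc t)) (Suc n))"
    by (simp add: sum.distrib algebra_simps tree_walks.simps(2)[of q "Suc t"] del: tree_walks.simps sum.atMost_Suc)
  also have "\<dots> = (\<Sum>n\<le>Suc (Suc t). h n * tree_walks q (Suc (Suc t)) n)"
    using h(2) by (subst (2) sum.atMost_Suc_shift) (simp del: tree_walks.simps)
  finally show ?case
    by simp
qed

section \<open>From exponential bounds to the limit superior of roots\<close>

lemma limsup_root_le:
  fixes b :: "nat \<Rightarrow> real"
  assumes "\<And>t. b t \<le> M * \<theta> ^ t" "\<theta> > 0"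
  shows "limsup (\<lambda>t. ereal (root t (b t))) \<le> ereal \<theta>"
proof -
  \<comment> \<open>The maximum makes the constant positive, so that its roots tend to 1.\<close>
  define M' where "M' = max M 1"
  have "(\<lambda>t. root t M' * \<theta>) \<longlonglongrightarrow> 1 * \<theta>"
    by (intro tendsto_mult LIMSEQ_root_const tendsto_const) (simp add: M'_def)
  then have lim: "limsup (\<lambda>t. ereal (root t M' * \<theta>)) = ereal \<theta>"
    by (intro lim_imp_Limsup) auto
  have "eventually (\<lambda>t. ereal (root t (b t)) \<le> ereal (root t M' * \<theta>)) sequentially"
    using eventually_gt_at_top[of 0]
  proof eventually_elim
    case (elim t)
    have "b t \<le> M' * \<theta> ^ t"
      using assms by (intro order_trans[OF assms(1)] mult_right_mono) (auto simp: M'_def)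
    then have "root t (b t) \<le> root t (M' * \<theta> ^ t)"
      using elim by simp
    also have "\<dots> = root t M' * \<theta>"
      using elim assms(2) by (simp add: real_root_mult real_root_power_cancel)
    finally show ?case by simp
  qed
  then show ?thesis
    unfolding lim[symmetric] by (rule Limsup_mono)
qed

lemma limsup_root_ge:
  fixes b :: "nat \<Rightarrow> real"
  assumes "\<And>t. c * \<theta> ^ t \<le> b (Suc t)" "c > 0" "\<theta> > 0"
  shows "ereal \<theta> \<le> limsup (\<lambda>t. ereal (root t (b t)))"
proof -
  \<comment> \<open>The shift from \<open>Suc t\<close> to \<open>t\<close> costs a factor
    \<open>1 / \<theta>\<close>, which the root makes negligible.\<close>
  have "(\<lambda>t. root t (c / \<theta>) * \<theta>) \<longlonglongrightarrow> 1 * \<theta>"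
    using assms by (intro tendsto_mult LIMSEQ_root_const tendsto_const) simp
  then have lim: "limsup (\<lambda>t. ereal (root t (c / \<theta>) * \<theta>)) = ereal \<theta>"
    by (intro lim_imp_Limsup) auto
  have "eventually (\<lambda>t. ereal (root t (c / \<theta>) * \<theta>) \<le> ereal (root t (b t))) sequentially"
    using eventually_gt_at_top[of 0]
  proof eventually_elim
    case (elim t)
    have "root t (c / \<theta>) * \<theta> = root t (c / \<theta> * \<theta> ^ t)"
      using elim assms(3) by (simp only: real_root_mult) (simp add: real_root_power_cancel)
    also have "c / \<theta> * \<theta> ^ t = c * \<theta> ^ (t - 1)"
      using elim assms(3) by (cases t) auto
    also have "root t (c * \<theta> ^ (t - 1)) \<le> root t (b t)"
      using elim assms(1)[of "t - 1"] by simp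
    finally show ?case by simp
  qed
  then show ?thesis
    unfolding lim[symmetric] by (rule Limsup_mono)
qed

section \<open>Counting walks by their last step\<close>

lemma vwalk_arcs_snoc: "p \<noteq> [] \<Longrightarrow> vwalk_arcs (p @ [g]) = vwalk_arcs p @ [(last p, g)]"
  by (induction p rule: vwalk_arcs.induct) auto

lemma vwalk_snoc:
  "p \<noteq> [] \<Longrightarrow> vwalk (p @ [g]) T \<longleftrightarrow> vwalk p T \<and> g \<in> verts T \<and> (last p, g) \<in> arcs_ends T"
  by (auto simp: vwalk_def vwalk_arcs_snoc)

context fin_free_on begin

abbreviation T where "T \<equiv> cayley_graph G X"

lemma lv_image: "lv ` letters = X \<union> m_inv G ` X"
  by (force simp: letters_def letter_val_def image_iff)

lemma verts_T [simp]: "verts T = carrier G"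
  by (simp add: cayley_graph_def)

lemma arcs_ends_T: "(g, h) \<in> arcs_ends T \<longleftrightarrow> g \<in> carrier G \<and> (\<exists>l\<in>letters. h = g \<otimes> lv l)"
proof -
  have "arcs_ends T = {(g, g \<otimes> s) | g s. g \<in> carrier G \<and> s \<in> lv ` letters}"
    unfolding lv_image by (force simp: cayley_graph_def arcs_ends_def arc_to_ends_def)
  then show ?thesis by blast
qed

definition walks :: "nat \<Rightarrow> 'a \<Rightarrow> 'a list set" where
  "walks t g = walks_to T \<one> {g} t"

lemma walks_altdef: "walks t g = {p. vwalk p T \<and> hd p = \<one> \<and> last p = g \<and> length p = Suc t}"
  by (auto simp: walks_def walks_to_def vwalk_def Suc_length_conv neq_Nil_conv)

lemma walks_0: "walks 0 g = (if g = \<one> then {[\<one>]} else {})"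
  by (auto simp: walks_altdef vwalk_def length_Suc_conv)

lemma walks_Suc:
  assumes g: "g \<in> carrier G"
  shows "walks (Suc t) g = (\<Union>l\<in>letters. (\<lambda>p. p @ [g]) ` walks t (g \<otimes> lv l))"
proof (intro subset_antisym subsetI)
  fix p assume "p \<in> walks (Suc t) g"
  then have p: "vwalk p T" "hd p = \<one>" "last p = g" "length p = Suc (Suc t)"
    by (auto simp: walks_altdef)
  define u where "u = butlast p"
  have "p \<noteq> []"
    using p(4) by auto
  then have u: "p = u @ [g]" "length u = Suc t"
    using p(4) by (simp_all add: u_def flip: p(3))
  then have ne: "u \<noteq> []"
    by auto
  have vu: "vwalk u T" and "(last u, g) \<in> arcs_ends T"
    using p(1) u(1) vwalk_snoc[OF ne] by auto
  then obtain l where l: "last u \<in> carrier G" "l \<in> letters" "g = last u \<otimes> lv l"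
    unfolding arcs_ends_T by blast
  then have "last u = g \<otimes> lv (linv l)"
    by (simp add: m_assoc)
  then have "u \<in> walks t (g \<otimes> lv (linv l))"
    using vu u ne p(2) by (auto simp: walks_altdef)
  moreover have "linv l \<in> letters"
    using l(2) by simp
  ultimately show "p \<in> (\<Union>l\<in>letters. (\<lambda>p. p @ [g]) ` walks t (g \<otimes> lv l))"
    using u(1) by blast
next
  fix p assume "p \<in> (\<Union>l\<in>letters. (\<lambda>p. p @ [g]) ` walks t (g \<otimes> lv l))"
  then obtain l u where l: "l \<in> letters" and p: "p = u @ [g]" and u: "u \<in> walks t (g \<otimes> lv l)"
    by blast
  have ne: "u \<noteq> []"
    using u by (auto simp: walks_altdef)
  have "g = (g \<otimes> lv l) \<otimes> lv (linv l)"
    using g l by (simp add: m_assoc)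
  then have "(last u, g) \<in> arcs_ends T"
    using u g l unfolding arcs_ends_T walks_altdef by (auto intro!: bexI[of _ "linv l"])
  then show "p \<in> walks (Suc t) g"
    using u p ne g vwalk_snoc[OF ne, of g T] by (auto simp: walks_altdef)
qed

lemma finite_walks: "g \<in> carrier G \<Longrightarrow> finite (walks t g)"
  by (induction t arbitrary: g) (auto simp: walks_0 walks_Suc)

lemma card_walks_Suc:
  assumes g: "g \<in> carrier G"
  shows "card (walks (Suc t) g) = (\<Sum>l\<in>letters. card (walks t (g \<otimes> lv l)))"
proof -
  have "card (walks (Suc t) g) = (\<Sum>l\<in>letters. card ((\<lambda>p. p @ [g]) ` walks t (g \<otimes> lv l)))"
    unfolding walks_Suc[OF g]
  proof (rule card_UN_disjoint)
    show "\<forall>l\<in>letters. finite ((\<lambda>p. p @ [g]) ` walks t (g \<otimes> lv l))"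
      using g finite_walks by simp
    show "\<forall>l\<in>letters. \<forall>m\<in>letters. l \<noteq> m \<longrightarrow>
        (\<lambda>p. p @ [g]) ` walks t (g \<otimes> lv l) \<inter> (\<lambda>p. p @ [g]) ` walks t (g \<otimes> lv m) = {}"
    proof (intro ballI impI)
      fix l m assume lm: "l \<in> letters" "m \<in> letters" "l \<noteq> m"
      then have "lv l \<noteq> lv m"
        using lv_inj by blast
      then have "g \<otimes> lv l \<noteq> g \<otimes> lv m"
        using g lm by simp
      then show "(\<lambda>p. p @ [g]) ` walks t (g \<otimes> lv l) \<inter> (\<lambda>p. p @ [g]) ` walks t (g \<otimes> lv m) = {}"
        by (auto simp: walks_altdef)
    qed
  qed simp
  then show ?thesis
    by (simp add: card_image inj_on_def)
qed

text \<open>Radial form of the adjacency operator: away from the root, one neighbour is reached by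
  undoing the last letter, and all others are farther away.\<close>

lemma sum_neighbours:
  fixes F :: "nat \<Rightarrow> real"
  assumes g: "g \<in> carrier G"
  shows "(\<Sum>l\<in>letters. F (len (g \<otimes> lv l))) =
    (if len g = 0 then 2 * real (card X) * F 1
     else F (len g - 1) + (2 * real (card X) - 1) * F (len g + 1))"
proof (cases "rw g = []")
  case True
  then have "len (g \<otimes> lv l) = 1" if "l \<in> letters" for l
    using rw_mult_letter[OF g that] by (simp add: len_def)
  then show ?thesis
    using True by (simp add: len_def[of g] card_letters)
next
  case False
  let ?b = "linv (last (rw g))"
  have b: "?b \<in> letters"
    using False rw_letters[OF g] by auto
  have "len (g \<otimes> lv ?b) = len g - 1"
    using rw_mult_letter[OF g b] False by (simp add: len_def)
  moreover have "len (g \<otimes> lv l) = len g + 1" if "l \<in> letters - {?b}" for l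
  proof -
    have "last (rw g) \<noteq> linv l"
      using that linv_linv[of l] by auto
    then show ?thesis
      using rw_mult_letter[OF g, of l] that by (simp add: len_def)
  qed
  ultimately have "(\<Sum>l\<in>letters. F (len (g \<otimes> lv l))) =
      F (len g - 1) + real (card (letters - {?b})) * F (len g + 1)"
    by (simp add: sum.remove[OF _ b])
  also have "real (card (letters - {?b})) = 2 * real (card X) - 1"
    using b card_X by (simp add: card_letters of_nat_diff)
  finally show ?thesis
    using False by (simp add: len_def)
qed

lemma card_walks:
  "g \<in> carrier G \<Longrightarrow> real (card (walks t g)) = tree_walks (2 * real (card X) - 1) t (len g)"
proof (induction t arbitrary: g)
  case 0
  then show ?case
    by (simp add: walks_0 len_eq_0_iff)
next
  case (Suc t)
  then show ?case
    by (simp add: card_walks_Suc sum_neighbours)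
qed

text \<open>A walk of length \<open>t\<close> stays within distance \<open>t\<close>, so finitely
  many end points occur even for infinite \<open>S\<close>.\<close>

lemma card_walks_to:
  assumes S: "S \<subseteq> carrier G"
  shows "real (card (walks_to T \<one> S t)) =
    (\<Sum>g | g \<in> S \<and> len g \<le> t. tree_walks (2 * real (card X) - 1) t (len g))"
proof -
  let ?B = "{g. g \<in> S \<and> len g \<le> t}"
  have far: "len g \<le> t" if "g \<in> carrier G" "p \<in> walks t g" for g p
  proof (rule ccontr)
    assume "\<not> len g \<le> t"
    then have "card (walks t g) = 0"
      using card_walks[OF that(1), of t] by (simp add: tree_walks_eq_0)
    then show False
      using that finite_walks[of g t] by auto
  qed
  have "walks_to T \<one> S t = (\<Union>g\<in>S. walks t g)"
    by (auto simp: walks_def walks_to_def)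
  also have "\<dots> = (\<Union>g\<in>?B. walks t g)"
    using far S by blast
  finally have "card (walks_to T \<one> S t) = card (\<Union>g\<in>?B. walks t g)"
    by simp
  also have "\<dots> = (\<Sum>g\<in>?B. card (walks t g))"
  proof (rule card_UN_disjoint)
    show "finite ?B"
      by (rule finite_subset[OF _ finite_ball[OF fin_X, of t]]) (use S in auto)
  qed (use S finite_walks in \<open>auto simp: walks_altdef\<close>)
  also have "real \<dots> = (\<Sum>g\<in>?B. tree_walks (2 * real (card X) - 1) t (len g))"
    unfolding of_nat_sum using S by (intro sum.cong card_walks) auto
  finally show ?thesis .
qed

section \<open>The upper bound\<close>

text \<open>\<open>tree_walks_le\<close> at \<open>s = \<sigma>\<close> turns the walk count into
  the weighted sum that \<open>prim_sum_bounded\<close> controls.\<close>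

lemma walk_growth_primitive_le:
  assumes \<sigma>: "0 < \<sigma>" "\<sigma> * (2 * real (card X) - 3) < 1" "\<sigma>\<^sup>2 * (2 * real (card X) - 1) < 1"
  shows "walk_growth T \<one> (primitive_words G) \<le> ereal ((2 * real (card X) - 1) * \<sigma> + 1 / \<sigma>)"
proof -
  let ?q = "2 * real (card X) - 1"
  have q: "?q \<ge> 0"
    using card_X by simp
  obtain M where M: "\<And>N. (\<Sum>g\<in>prim_ball N. \<sigma> ^ len g) \<le> M"
    using prim_sum_bounded[OF \<sigma>] by blast
  let ?\<theta> = "?q * \<sigma> + 1 / \<sigma>"
  have \<theta>: "?\<theta> > 0"
    using \<sigma> q by (intro add_nonneg_pos) auto
  have "real (card (walks_to T \<one> (primitive_words G) t)) \<le> M * ?\<theta> ^ t" for t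
  proof -
    have "real (card (walks_to T \<one> (primitive_words G) t)) =
        (\<Sum>g\<in>prim_ball t. tree_walks ?q t (len g))"
      unfolding prim_ball_def using primitive_carrier by (intro card_walks_to) auto
    also have "\<dots> \<le> (\<Sum>g\<in>prim_ball t. ?\<theta> ^ t * \<sigma> ^ len g)"
      using \<sigma>_less_1[OF \<sigma>] \<sigma>(1) q by (intro sum_mono tree_walks_le) auto
    also have "\<dots> = ?\<theta> ^ t * (\<Sum>g\<in>prim_ball t. \<sigma> ^ len g)"
      by (simp add: sum_distrib_left)
    also have "\<dots> \<le> ?\<theta> ^ t * M"
      using M \<theta> by (intro mult_left_mono) auto
    finally show ?thesis
      by (simp add: mult.commute)
  qed
  then show ?thesis
    unfolding walk_growth_def using \<theta> by (rule limsup_root_le)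
qed

section \<open>The lower bound\<close>

definition transvection :: "'a \<Rightarrow> 'a \<Rightarrow> 'a \<times> bool \<Rightarrow> 'a" where
  "transvection x u l =
    (if l = (x, True) then x \<otimes> u else if l = (x, False) then inv (x \<otimes> u) else lv l)"

text \<open>The element is the image of \<open>x\<close> under the endomorphism that sends
  \<open>x\<close> to \<open>x \<otimes> u\<close>, with \<open>u = wv w\<close>, and fixes the
  other basis elements. As \<open>u\<close> does not involve \<open>x\<close>, it is fixed as well,
  so replacing \<open>u\<close> by its inverse gives the inverse map.\<close>

lemma transvection_primitive:
  assumes x: "x \<in> X" and w: "set w \<subseteq> (X - {x}) \<times> UNIV"
  shows "x \<otimes> wv w \<in> primitive_words G"
proof -
  have w_letters: "set w \<subseteq> letters"
    using w by (auto simp: letters_def)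
  let ?u = "wv w"
  have xc: "x \<in> carrier G" and u: "?u \<in> carrier G"
    using x X_subset w_letters by auto
  have tv_closed: "transvection x v l \<in> carrier G" if "v \<in> carrier G" "l \<in> letters" for v l
    using that xc by (simp add: transvection_def)
  have tv_linv: "transvection x v (linv l) = inv (transvection x v l)"
    if "v \<in> carrier G" "l \<in> letters" for v l
    using that xc lv_linv[OF that(2)]
    by (cases l) (auto simp: transvection_def linv_Pair)
  have hom: "ext (transvection x v) \<in> hom G G"
    and on_lv: "l \<in> letters \<Longrightarrow> ext (transvection x v) (lv l) = transvection x v l"
    and on_u: "ext (transvection x v) ?u = ?u" if v: "v \<in> carrier G" for v l
  proof -
    show "ext (transvection x v) \<in> hom G G"
      using v by (intro ext_hom tv_closed tv_linv)
    show "ext (transvection x v) (lv l) = transvection x v l" if "l \<in> letters"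
      using v that by (intro ext_lv tv_closed tv_linv)
    have "ext (transvection x v) ?u = word_prod G (transvection x v) w"
      using v w_letters by (intro ext_wv tv_closed tv_linv)
    also have "\<dots> = word_prod G lv w"
      unfolding word_prod_def using w
      by (intro foldr_cong refl) (auto simp: transvection_def)
    finally show "ext (transvection x v) ?u = ?u"
      by (simp add: word_val_conv_word_prod)
  qed
  have on_x: "ext (transvection x v) x = x \<otimes> v" if "v \<in> carrier G" for v
  proof -
    have "(x, True) \<in> letters" "lv (x, True) = x"
      using x by (simp_all add: letters_def letter_val_def)
    then show ?thesis
      using on_lv[OF that, of "(x, True)"] by (simp add: transvection_def)
  qed
  have on_y: "ext (transvection x v) y = y" if "v \<in> carrier G" "y \<in> X" "y \<noteq> x" for v y
  proof -
    have "(y, True) \<in> letters" "lv (y, True) = y"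
      using that by (simp_all add: letters_def letter_val_def)
    then show ?thesis
      using on_lv[OF that(1), of "(y, True)"] that(3) by (simp add: transvection_def)
  qed
  have inverse: "ext (transvection x v) (ext (transvection x (inv v)) y) = y"
    if v: "v \<in> carrier G" "ext (transvection x v) v = v" and y: "y \<in> X" for v y
  proof (cases "y = x")
    case True
    interpret \<phi>: group_hom G G "ext (transvection x v)"
      using hom[OF v(1)] by unfold_locales
    show ?thesis
      using True v xc on_x by (simp add: m_assoc)
  next
    case False
    then show ?thesis
      using v y on_y by simp
  qed
  have u': "inv ?u \<in> carrier G" "ext (transvection x (inv ?u)) (inv ?u) = inv ?u"
  proof -
    show c: "inv ?u \<in> carrier G"
      using u by simp
    interpret \<phi>: group_hom G G "ext (transvection x (inv ?u))"
      using hom[OF c] by unfold_locales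
    show "ext (transvection x (inv ?u)) (inv ?u) = inv ?u"
      using u on_u[OF c] by simp
  qed
  have "ext (transvection x ?u) \<in> iso G G"
    using inverse[OF u on_u[OF u]] inverse[OF u'] u
    by (intro isoI_inverse[OF hom[OF u] hom[OF u'(1)]]) simp_all
  moreover have "x \<in> primitive_words G"
    using x basis by (auto simp: primitive_words_def)
  ultimately show ?thesis
    using primitive_iso on_x[OF u] by metis
qed

text \<open>There are \<open>2 * card X - 2\<close> letters to choose from, and at most one of them
  would cancel with the next letter.\<close>

lemma card_words_avoiding_ge:
  assumes x: "x \<in> X"
  shows "(2 * card X - 3) ^ n \<le> card {w \<in> RW. set w \<subseteq> (X - {x}) \<times> UNIV \<and> length w = n}"
proof (induction n)
  case 0
  have "{w \<in> RW. set w \<subseteq> (X - {x}) \<times> UNIV \<and> length w = 0} = {[]}"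
    by auto
  then show ?case by simp
next
  case (Suc n)
  let ?L = "(X - {x}) \<times> (UNIV :: bool set)"
  let ?F = "\<lambda>n. {w \<in> RW. set w \<subseteq> ?L \<and> length w = n}"
  \<comment> \<open>For empty \<open>w\<close> the letter \<open>hd w\<close> is unspecified;
    excluding one letter more is harmless for a lower bound.\<close>
  let ?D = "SIGMA w:?F n. ?L - {linv (hd w)}"
  have fin: "finite (?F n)" for n
    by (rule finite_subset[OF _ finite_RW_le[OF fin_X, of n]]) auto
  have finL: "finite ?L"
    using fin_X by simp
  have cL: "card ?L = 2 * card X - 2"
    using x fin_X by (simp add: card_cartesian_product card_Diff_singleton)
  have "(2 * card X - 3) ^ Suc n \<le> (\<Sum>w\<in>?F n. 2 * card X - 3)"
    using Suc by simp
  also have "\<dots> \<le> (\<Sum>w\<in>?F n. card (?L - {linv (hd w)}))"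
  proof (rule sum_mono)
    fix w
    have "card ?L - 1 \<le> card (?L - {linv (hd w)})"
      using diff_card_le_card_Diff[of "{linv (hd w)}" ?L] by simp
    then show "2 * card X - 3 \<le> card (?L - {linv (hd w)})"
      using cL by simp
  qed
  also have "\<dots> = card ?D"
    using fin finL by (simp add: card_SigmaI)
  also have "\<dots> = card ((\<lambda>(w, b). b # w) ` ?D)"
    by (intro card_image[symmetric]) (auto simp: inj_on_def)
  also have "\<dots> \<le> card (?F (Suc n))"
  proof (rule card_mono[OF fin], rule subsetI)
    fix v assume "v \<in> (\<lambda>(w, b). b # w) ` ?D"
    then obtain w b where v: "v = b # w" "w \<in> ?F n" "b \<in> ?L" "b \<noteq> linv (hd w)"
      by auto
    then have "hd w \<noteq> linv b"
      by (metis linv_linv)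
    then show "v \<in> ?F (Suc n)"
      using v by (auto simp: RW_Cons_iff letters_def)
  qed
  finally show ?case .
qed

text \<open>The witnesses are the words \<open>x w\<close> with \<open>w\<close> free of
  \<open>x\<close> and its inverse; they are reduced as nothing in \<open>w\<close> cancels
  \<open>x\<close>.\<close>

lemma card_primitive_sphere_ge:
  assumes "n \<le> N"
  shows "(2 * card X - 3) ^ n \<le> card {g \<in> prim_ball (Suc N). len g = Suc n}"
proof -
  obtain x where x: "x \<in> X"
    using card_X by fastforce
  let ?F = "{w \<in> RW. set w \<subseteq> (X - {x}) \<times> UNIV \<and> length w = n}"
  have RW: "(x, True) # w \<in> RW" if "w \<in> ?F" for w
    using that x by (cases w) (auto simp: RW_Cons_iff letters_def linv_Pair)
  have val: "wv ((x, True) # w) = x \<otimes> wv w" for w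
    by (simp add: wv_Cons letter_val_def)
  have "inj_on (\<lambda>w. wv ((x, True) # w)) ?F"
  proof (rule inj_onI)
    fix u w assume "u \<in> ?F" "w \<in> ?F" "wv ((x, True) # u) = wv ((x, True) # w)"
    then show "u = w"
      using wv_inj[OF RW[of u] RW[of w]] by blast
  qed
  then have "card ?F = card ((\<lambda>w. wv ((x, True) # w)) ` ?F)"
    by (rule card_image[symmetric])
  also have "\<dots> \<le> card {g \<in> prim_ball (Suc N). len g = Suc n}"
  proof (rule card_mono, simp, rule subsetI)
    fix g assume "g \<in> (\<lambda>w. wv ((x, True) # w)) ` ?F"
    then obtain w where w: "w \<in> ?F" "g = wv ((x, True) # w)"
      by blast
    have "g \<in> primitive_words G"
      unfolding w(2) val using w(1) x by (intro transvection_primitive) auto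
    moreover have "len g = Suc n"
      using RW[OF w(1)] w by (simp add: len_def)
    ultimately show "g \<in> {g \<in> prim_ball (Suc N). len g = Suc n}"
      using assms by (simp add: prim_ball_def)
  qed
  finally show ?thesis
    using card_words_avoiding_ge[OF x, of n] by linarith
qed

text \<open>By the bound with \<open>C\<close>, the sphere of radius \<open>n + 1\<close> has at
  least \<open>h (Suc n) / C\<close> primitive elements. Hence the number of walks to primitive
  elements dominates the sum that \<open>tree_walks_subsolution\<close> bounds from below.\<close>

lemma walk_growth_primitive_ge:
  fixes h :: "nat \<Rightarrow> real"
  assumes \<theta>: "\<theta> > 0" and h: "\<And>n. h n \<ge> 0" "h 0 = 0" "h 1 > 0"
    and sub: "\<And>n. \<theta> * h (Suc n) \<le> h (n + 2) + (2 * real (card X) - 1) * h n"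
    and C: "C > 0" "\<And>n. h (Suc n) \<le> C * (2 * real (card X) - 3) ^ n"
  shows "ereal \<theta> \<le> walk_growth T \<one> (primitive_words G)"
proof -
  let ?q = "2 * real (card X) - 1"
  have q: "?q \<ge> 0"
    using card_X by simp
  have "h 1 / C * \<theta> ^ t \<le> real (card (walks_to T \<one> (primitive_words G) (Suc t)))" for t
  proof -
    let ?w = "tree_walks ?q (Suc t)"
    let ?S = "\<lambda>n. {g \<in> prim_ball (Suc t). len g = n}"
    have "h 1 * \<theta> ^ t \<le> (\<Sum>n\<le>Suc t. h n * ?w n)"
      using \<theta> h sub q by (intro tree_walks_subsolution) auto
    also have "\<dots> = (\<Sum>n\<le>t. h (Suc n) * ?w (Suc n))"
      using h(2) by (subst sum.atMost_Suc_shift) (simp del: tree_walks.simps)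
    also have "\<dots> \<le> (\<Sum>n\<le>t. (C * real (card (?S (Suc n)))) * ?w (Suc n))"
    proof (intro sum_mono mult_right_mono tree_walks_nonneg q)
      fix n assume "n \<in> {..t}"
      then have "real ((2 * card X - 3) ^ n) \<le> real (card (?S (Suc n)))"
        using card_primitive_sphere_ge[of n t] by (intro of_nat_mono) simp
      also have "real ((2 * card X - 3) ^ n) = (2 * real (card X) - 3) ^ n"
        using card_X by (simp add: of_nat_diff)
      finally show "h (Suc n) \<le> C * real (card (?S (Suc n)))"
        using C(1) by (intro order_trans[OF C(2)] mult_left_mono) auto
    qed
    also have "\<dots> \<le> (\<Sum>n\<le>Suc t. (C * real (card (?S n))) * ?w n)"
      using C(1) tree_walks_nonneg[OF q]
      by (subst sum.atMost_Suc_shift) (simp del: tree_walks.simps)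
    also have "\<dots> = C * (\<Sum>n\<le>Suc t. \<Sum>g\<in>?S n. ?w (len g))"
      by (simp add: sum_distrib_left mult_ac del: tree_walks.simps sum.atMost_Suc)
    also have "(\<Sum>n\<le>Suc t. \<Sum>g\<in>?S n. ?w (len g)) = (\<Sum>g\<in>prim_ball (Suc t). ?w (len g))"
      by (rule sum.group[OF finite_prim_ball(1)]) (auto simp: prim_ball_def)
    also have "\<dots> = real (card (walks_to T \<one> (primitive_words G) (Suc t)))"
      unfolding prim_ball_def using primitive_carrier by (intro card_walks_to[symmetric]) auto
    finally show ?thesis
      using C(1) by (simp add: field_simps)
  qed
  then show ?thesis
    unfolding walk_growth_def using h(3) C(1) \<theta> by (intro limsup_root_ge[where c = "h 1 / C"]) simp_all
qed

end

text \<open>In rank 2 one has \<open>q = 3\<close> and \<open>2 * r - 3 = 1\<close>, so a bounded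
  subsolution is required. The sine solves the recursion exactly, is positive strictly between its
  zeros at 0 and \<open>N\<close>, and is cut off beyond \<open>N\<close>.\<close>

lemma sqrt3_sin_subsolution:
  fixes N :: nat
  assumes N: "N \<ge> 3"
  defines "h \<equiv> \<lambda>n. if n \<le> N then sqrt 3 ^ n * sin (real n * (pi / real N)) else 0"
  shows "h n \<ge> 0" "h 0 = 0" "h 1 > 0" "h n \<le> sqrt 3 ^ N"
    "2 * sqrt 3 * cos (pi / real N) * h (Suc n) \<le> h (n + 2) + 3 * h n"
proof -
  let ?x = "pi / real N"
  have x: "0 < ?x" "?x < pi / 2"
    using N pi_gt_zero by (auto simp: field_simps)
  show nonneg: "h n \<ge> 0" for n
  proof (cases "n \<le> N")
    case True
    then have "real n * ?x \<le> real N * ?x"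
      using x by (intro mult_right_mono) auto
    then have "real n * ?x \<le> pi"
      using N by simp
    then have "sin (real n * ?x) \<ge> 0"
      using x by (intro sin_ge_zero) auto
    then show ?thesis
      by (simp add: h_def)
  qed (simp add: h_def)
  show "h 0 = 0"
    by (simp add: h_def)
  have "sin ?x > 0"
    using x pi_gt_zero by (intro sin_gt_zero) linarith+
  then show "h 1 > 0"
    using N by (simp add: h_def)
  show "h n \<le> sqrt 3 ^ N"
  proof (cases "n \<le> N")
    case True
    have "sqrt 3 ^ n * sin (real n * ?x) \<le> sqrt 3 ^ n * 1"
      by (intro mult_left_mono) auto
    also have "\<dots> \<le> sqrt 3 ^ N"
      using True power_increasing[of n N "sqrt 3"] by simp
    finally have "sqrt 3 ^ n * sin (real n * ?x) \<le> sqrt 3 ^ N" .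
    then show ?thesis
      using True by (simp add: h_def)
  qed (simp add: h_def)
  have h_N: "h N = 0"
    using N by (simp add: h_def)
  show "2 * sqrt 3 * cos ?x * h (Suc n) \<le> h (n + 2) + 3 * h n"
  proof (cases "Suc n < N")
    case True
    have A: "sin (real (n + 2) * ?x) + sin (real n * ?x) = 2 * cos ?x * sin (real (Suc n) * ?x)"
    proof -
      have "real (n + 2) * ?x = real (Suc n) * ?x + ?x" "real n * ?x = real (Suc n) * ?x - ?x"
        by (simp_all add: algebra_simps add_divide_distrib)
      then show ?thesis
        by (simp only: sin_add sin_diff) simp
    qed
    have B: "h (n + 2) + 3 * h n =
        3 * sqrt 3 ^ n * (sin (real (n + 2) * ?x) + sin (real n * ?x))"
      using True by (simp add: h_def algebra_simps)
    have C: "2 * sqrt 3 * cos ?x * h (Suc n) =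
        3 * sqrt 3 ^ n * (2 * cos ?x * sin (real (Suc n) * ?x))"
      using True by (simp add: h_def algebra_simps)
    show ?thesis
      unfolding A B C ..
  next
    \<comment> \<open>From \<open>N\<close> on the left side vanishes, so the cut-off does no
      harm.\<close>
    case False
    then have "h (Suc n) = 0"
      using h_N by (cases "Suc n = N") (auto simp: h_def)
    then show ?thesis
      using nonneg[of "n + 2"] nonneg[of n] by simp
  qed
qed

text \<open>\<open>a\<close> and \<open>q / a\<close> are the roots of the characteristic polynomial
  of the recursion with eigenvalue \<open>a + q / a\<close>. The difference of their powers is the
  solution that vanishes at 0.\<close>

lemma power_subsolution:
  fixes a q :: real
  assumes "a > 0" "0 \<le> q" "q < a\<^sup>2"
  defines "h \<equiv> \<lambda>n. a ^ n - (q / a) ^ n"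
  shows "h n \<ge> 0" "h 0 = 0" "h 1 > 0" "h (Suc n) \<le> a * a ^ n"
    "(a + q / a) * h (Suc n) \<le> h (n + 2) + q * h n"
proof -
  have "q / a < a"
    using assms by (simp add: field_simps power2_eq_square)
  then show "h n \<ge> 0" "h 1 > 0"
    using assms by (auto simp: h_def intro: power_mono)
  show "h 0 = 0" "h (Suc n) \<le> a * a ^ n"
    using assms by (auto simp: h_def)
  have "(a + q / a) * h (Suc n) = h (n + 2) + q * h n"
    using assms(1) by (simp add: h_def field_simps)
  then show "(a + q / a) * h (Suc n) \<le> h (n + 2) + q * h n"
    by simp
qed

theorem corollary1p4:
  fixes G :: "('a, 'b) monoid_scheme" and X :: "'a set" and r :: nat
  assumes "group G"
    and "free_basis G X"
    and "card X = r"
    and "r \<ge> 2"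
  shows "walk_growth (cayley_graph G X) \<one>\<^bsub>G\<^esub> (primitive_words G) =
    ereal (if r = 2 then 2 * sqrt 3
           else 2 * real r - 3 + (2 * real r - 1) / (2 * real r - 3))"
proof -
  interpret group G
    by fact
  interpret fin_free_on G X
    using assms by unfold_locales (auto intro: card_ge_0_finite)
  let ?q = "2 * real r - 1" and ?\<beta> = "walk_growth (cayley_graph G X) \<one>\<^bsub>G\<^esub> (primitive_words G)"
  \<comment> \<open>This is the maximum of \<open>2 * r - 3\<close> and
    \<open>sqrt (2 * r - 1)\<close>, the reciprocal of the critical \<open>\<sigma>\<close>; in both
    cases the claimed value is \<open>a + ?q / a\<close>.\<close>
  define a where "a = (if r = 2 then sqrt 3 else 2 * real r - 3)"
  have a: "a > 0" "2 * real r - 3 \<le> a" "?q \<le> a\<^sup>2"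
  proof -
    have "?q \<le> (2 * real r - 3)\<^sup>2" if "r \<noteq> 2"
    proof -
      \<comment> \<open>The product is the difference of the two sides of the claim.\<close>
      have "0 \<le> (2 * real r - 5) * (2 * real r - 2)"
        using assms(4) that by (intro mult_nonneg_nonneg) auto
      then show ?thesis
        by (simp add: power2_eq_square algebra_simps)
    qed
    then show "a > 0" "2 * real r - 3 \<le> a" "?q \<le> a\<^sup>2"
      using assms(4) by (auto simp: a_def)
  qed
  have goal: "(if r = 2 then 2 * sqrt 3 else 2 * real r - 3 + ?q / (2 * real r - 3)) = a + ?q / a"
    by (simp add: a_def real_div_sqrt)
  have "?\<beta> \<le> ereal (a + ?q / a)"
  \<comment> \<open>The bound holds for all positive \<open>\<sigma>\<close> below
    \<open>1 / a\<close>; let \<open>\<sigma>\<close> tend to \<open>1 / a\<close> from the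
    left.\<close>
  proof (rule tendsto_lowerbound)
    have "((\<lambda>\<sigma>. ?q * \<sigma> + 1 / \<sigma>) \<longlongrightarrow> ?q * (1 / a) + 1 / (1 / a)) (at_left (1 / a))"
      using a(1) by (intro tendsto_intros) auto
    then show "((\<lambda>\<sigma>. ereal (?q * \<sigma> + 1 / \<sigma>)) \<longlongrightarrow> ereal (a + ?q / a)) (at_left (1 / a))"
      by (simp add: add.commute)
    have "eventually (\<lambda>\<sigma>. \<sigma> \<in> {0<..<1 / a}) (at_left (1 / a))"
      using a(1) by (intro eventually_at_left_real) simp
    then show "eventually (\<lambda>\<sigma>. ?\<beta> \<le> ereal (?q * \<sigma> + 1 / \<sigma>)) (at_left (1 / a))"
    proof eventually_elim
      case (elim \<sigma>)
      then have \<sigma>: "0 < \<sigma>" "\<sigma> * a < 1"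
        using a(1) by (auto simp: field_simps)
      have "\<sigma> * (2 * real r - 3) \<le> \<sigma> * a"
        using \<sigma> a by (intro mult_left_mono) auto
      then have 1: "\<sigma> * (2 * real r - 3) < 1"
        using \<sigma> by linarith
      have "\<sigma>\<^sup>2 * ?q \<le> (\<sigma> * a)\<^sup>2"
        unfolding power_mult_distrib using a by (intro mult_left_mono) auto
      also have "(\<sigma> * a)\<^sup>2 < 1"
        using \<sigma> a by (simp add: power_less_one_iff)
      finally show ?case
        using walk_growth_primitive_le[of \<sigma>] \<sigma> assms(3) 1 by simp
    qed
  qed (simp add: trivial_limit_at_left_real)
  moreover have "ereal (a + ?q / a) \<le> ?\<beta>"
  proof (cases "r = 2")
    case True
    have bound: "ereal (2 * sqrt 3 * cos (pi / real N)) \<le> ?\<beta>" if N: "N \<ge> 3" for N :: nat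
    proof -
      have "pi / real N < pi / 2"
        using N pi_gt_zero by (intro divide_strict_left_mono) auto
      then have "cos (pi / real N) > 0"
        using N by (intro cos_gt_zero_pi) (auto intro: less_trans[of _ 0])
      then show ?thesis
        using sqrt3_sin_subsolution[OF N] True assms(3)
        by (intro walk_growth_primitive_ge[where C = "sqrt 3 ^ N",
              OF _ sqrt3_sin_subsolution(1-3)[OF N]]) simp_all
    qed
    \<comment> \<open>As \<open>N\<close> grows, the cosine tends to 1 and the bound reaches
      \<open>2 * sqrt 3\<close>.\<close>
    have "(\<lambda>N. ereal (2 * sqrt 3 * cos (pi / real N))) \<longlonglongrightarrow> ereal (2 * sqrt 3 * cos 0)"
      by (intro tendsto_intros lim_const_over_n)
    then have "ereal (2 * sqrt 3 * cos 0) \<le> ?\<beta>"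
      by (rule LIMSEQ_le_const2) (use bound in blast)
    then show ?thesis
      using True goal by simp
  next
    case False
    \<comment> \<open>From rank 3 on the inequality is strict, so that the two roots differ and
      \<open>h 1\<close> is positive.\<close>
    have "0 < (2 * real r - 5) * (2 * real r - 2)"
      using assms(4) False by (intro mult_pos_pos) auto
    then have "?q < a\<^sup>2"
      using False by (simp add: a_def power2_eq_square algebra_simps)
    moreover have q: "0 \<le> ?q"
      using assms(4) by simp
    ultimately show ?thesis
      using power_subsolution[OF a(1) q] a(1) q False assms(3)
      by (intro walk_growth_primitive_ge[where C = a and h = "\<lambda>n. a ^ n - (?q / a) ^ n"])
        (auto simp: a_def intro: add_pos_nonneg)
  qed
  ultimately show ?thesis
    unfolding goal by (rule antisym)
qed

end
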